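(* Let $K$ be a commutative Frobenius ring and let $A$ be a non projective Frobenius $K$-algebra with Frobenius functional $\epsilon:A\to K$. Let $B$ be a ring, let ${}_AM_B$ and ${}_BN_A$ be bimodules such that ${}_AM$ and $N_A$ have finite length, and let $\langle -,-\rangle:M\times N\to A$ be a non degenerate $A$-bilinear form. For subsets $S\subseteq N$ and $T\subseteq M$ put $$ {}'S=\{m\in M:\langle m,s\rangle=0\ \forall s\in S\},\qquad T'=\{n\in N:\langle t,n\rangle=0\ \forall t\in T\},$$ $$ {}^{\epsilon}S=\{m\in M:\epsilon(\langle m,s\rangle)=0\ \forall s\in S\},\qquad T^{\epsilon}=\{n\in N:\epsilon(\langle t,n\rangle)=0\ \forall t\in T\}.$$ Let $S$ and $T$ be $A$-submodules of $N_A$ and ${}_AM$, respectively. Then $$ {}'S={}^{\epsilon}S,\qquad T'=T^{\epsilon}.$$ Thus, ${}^{\epsilon}S$ and $T^{\epsilon}$ are $A$-submodules of, respectively, ${}_AM$ and $N_A$. Moreover, $$({}'S)'=S=({}^{\epsilon}S)^{\epsilon},\qquad {}'(T')=T={}^{\epsilon}(T^{\epsilon}).$$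
   Context: All rings are unital and possibly noncommutative. A left and right artinian ring $A$ with Jacobson radical $J$ is called Frobenius if $\operatorname{Soc}({}_AA)\cong A/J$ as left $A$-modules and $\operatorname{Soc}(A_A)\cong A/J$ as right $A$-modules, where $\operatorname{Soc}$ denotes the socle. A $K$-algebra $A$ over a commutative Frobenius ring $K$ is called non projective Frobenius ("not necessarily projective" as a $K$-module) if it is finitely generated as a $K$-module and there exists a $K$-bilinear form $\langle -,-\rangle_\epsilon:A\times A\to K$ that is associative ($\langle aa',a''\rangle_\epsilon=\langle a,a'a''\rangle_\epsilon$) and non degenerate (the only $a\in A$ with $\langle a,A\rangle_\epsilon=0$ is $a=0$, and the only $a$ with $\langle A,a\rangle_\epsilon=0$ is $a=0$). The associated Frobenius functional is the $K$-linear map $\epsilon:A\to K$, $\epsilon(a)=\langle 1,a\rangle_\epsilon=\langle a,1\rangle_\epsilon$, so that $\langle a,a'\rangle_\epsilon=\epsilon(aa')$ for all $a,a'\in A$. A map $\langle -,-\rangle:M\times N\to A$, with ${}_AM$ a left and $N_A$ a right $A$-module, is $A$-bilinear if it is biadditive and $\langle am,na'\rangle=a\langle m,n\rangle a'$ for all $a,a'\in A$, $m\in M$, $n\in N$. It is non degenerate if both maps $\alpha:M\to\operatorname{Hom}_A(N_A,A_A)$, $\alpha(m)(n)=\langle m,n\rangle$, and $\beta:N\to\operatorname{Hom}_A({}_AM,{}_AA)$, $\beta(n)(m)=\langle m,n\rangle$, are injective. The ring $K$ acts on $M$ and $N$ through $A$. *)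

theory Defs
  imports "HOL-Algebra.Module" "HOL-Algebra.AbelCoset"
begin

text \<open>
  The locale \<^locale>\<open>module\<close> is restricted to commutative rings of scalars; the following is its
  verbatim analogue for unital left modules over an arbitrary (unital) ring. The locale
  \<^locale>\<open>submodule\<close> makes no use of commutativity and is used as it stands.
\<close>

locale left_module = R?: ring R + M?: abelian_group M
  for R :: "('a, 'y) ring_scheme" and M :: "('a, 'm, 'z) module_scheme" (structure) +
  assumes smult_closed [simp, intro]:
      "\<lbrakk>a \<in> carrier R; x \<in> carrier M\<rbrakk> \<Longrightarrow> a \<odot> x \<in> carrier M"
    and smult_l_distr:
      "\<lbrakk>a \<in> carrier R; b \<in> carrier R; x \<in> carrier M\<rbrakk> \<Longrightarrow> (a \<oplus>\<^bsub>R\<^esub> b) \<odot> x = a \<odot> x \<oplus> b \<odot> x"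
    and smult_r_distr:
      "\<lbrakk>a \<in> carrier R; x \<in> carrier M; y \<in> carrier M\<rbrakk> \<Longrightarrow> a \<odot> (x \<oplus> y) = a \<odot> x \<oplus> a \<odot> y"
    and smult_assoc1:
      "\<lbrakk>a \<in> carrier R; b \<in> carrier R; x \<in> carrier M\<rbrakk> \<Longrightarrow> (a \<otimes>\<^bsub>R\<^esub> b) \<odot> x = a \<odot> (b \<odot> x)"
    and smult_one [simp]:
      "x \<in> carrier M \<Longrightarrow> \<one>\<^bsub>R\<^esub> \<odot> x = x"

text \<open>
  Right \<open>R\<close>-modules are left modules over the opposite ring: if \<^term>\<open>left_module (opp R) N\<close>, then
  \<^term>\<open>smult N a n\<close> stands for \<open>n a\<close>, and associativity reads \<open>n (b a) = (n b) a\<close>. Submodules,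
  socles, composition series, \dots of right modules are those over \<^term>\<open>opp R\<close>.
\<close>

definition opp :: "('a, 'z) ring_scheme \<Rightarrow> ('a, 'z) ring_scheme"
  where "opp R = R\<lparr>mult := (\<lambda>x y. y \<otimes>\<^bsub>R\<^esub> x)\<rparr>"

abbreviation right_module :: "('a, 'y) ring_scheme \<Rightarrow> ('a, 'm, 'z) module_scheme \<Rightarrow> bool"
  where "right_module R N \<equiv> left_module (opp R) N"

definition regular :: "('a, 'z) ring_scheme \<Rightarrow> ('a, 'a) module"
  where "regular R =
    \<lparr>carrier = carrier R, mult = mult R, one = \<one>\<^bsub>R\<^esub>, zero = \<zero>\<^bsub>R\<^esub>, add = add R, smult = mult R\<rparr>"

record ('a, 'b, 'm) bimodule = "('a, 'm) module" +
  rsmult :: "'m \<Rightarrow> 'b \<Rightarrow> 'm"  (infixl \<open>\<lhd>\<index>\<close> 70)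

definition right_part :: "('a, 'b, 'm, 'z) bimodule_scheme \<Rightarrow> ('b, 'm) module"
  where "right_part M =
    \<lparr>carrier = carrier M, mult = mult M, one = \<one>\<^bsub>M\<^esub>, zero = \<zero>\<^bsub>M\<^esub>, add = add M,
     smult = (\<lambda>b x. x \<lhd>\<^bsub>M\<^esub> b)\<rparr>"

definition bimodule ::
    "('a, 'x) ring_scheme \<Rightarrow> ('b, 'y) ring_scheme \<Rightarrow> ('a, 'b, 'm, 'z) bimodule_scheme \<Rightarrow> bool"
  where "bimodule R S M \<longleftrightarrow>
    left_module R M \<and> right_module S (right_part M) \<and>
    (\<forall>a\<in>carrier R. \<forall>b\<in>carrier S. \<forall>x\<in>carrier M.
      (a \<odot>\<^bsub>M\<^esub> x) \<lhd>\<^bsub>M\<^esub> b = a \<odot>\<^bsub>M\<^esub> (x \<lhd>\<^bsub>M\<^esub> b))"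

text \<open>The fields \<open>mult\<close> and \<open>one\<close> that a module record inherits from rings are irrelevant for its module
  structure, and are left unspecified for quotient modules.\<close>

definition quot_module :: "('a, 'm, 'z) module_scheme \<Rightarrow> 'm set \<Rightarrow> ('a, 'm set) module"
  where "quot_module M H =
    \<lparr>carrier = a_rcosets\<^bsub>M\<^esub> H, mult = undefined, one = undefined, zero = H, add = set_add M,
     smult = (\<lambda>a X. \<Union>x\<in>X. H +>\<^bsub>M\<^esub> (a \<odot>\<^bsub>M\<^esub> x))\<rparr>"

definition mod_iso ::
    "('a, 'x) ring_scheme \<Rightarrow> ('a, 'm, 'y) module_scheme \<Rightarrow> ('a, 'n, 'z) module_scheme \<Rightarrow> bool"
  where "mod_iso R M N \<longleftrightarrow>
    (\<exists>f. bij_betw f (carrier M) (carrier N) \<and>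
      (\<forall>x\<in>carrier M. \<forall>y\<in>carrier M. f (x \<oplus>\<^bsub>M\<^esub> y) = f x \<oplus>\<^bsub>N\<^esub> f y) \<and>
      (\<forall>a\<in>carrier R. \<forall>x\<in>carrier M. f (a \<odot>\<^bsub>M\<^esub> x) = a \<odot>\<^bsub>N\<^esub> f x))"

definition mod_span :: "('a, 'x) ring_scheme \<Rightarrow> ('a, 'm, 'z) module_scheme \<Rightarrow> 'm set \<Rightarrow> 'm set"
  where "mod_span R M X = \<Inter>{H. submodule H R M \<and> X \<subseteq> H}"

definition fin_gen :: "('a, 'x) ring_scheme \<Rightarrow> ('a, 'm, 'z) module_scheme \<Rightarrow> bool"
  where "fin_gen R M \<longleftrightarrow> (\<exists>X. finite X \<and> X \<subseteq> carrier M \<and> mod_span R M X = carrier M)"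

definition simple_module :: "('a, 'x) ring_scheme \<Rightarrow> ('a, 'm, 'z) module_scheme \<Rightarrow> bool"
  where "simple_module R M \<longleftrightarrow>
    left_module R M \<and> carrier M \<noteq> {\<zero>\<^bsub>M\<^esub>} \<and>
    (\<forall>H. submodule H R M \<longrightarrow> H = {\<zero>\<^bsub>M\<^esub>} \<or> H = carrier M)"

definition finite_length :: "('a, 'x) ring_scheme \<Rightarrow> ('a, 'm, 'z) module_scheme \<Rightarrow> bool"
  where "finite_length R M \<longleftrightarrow>
    (\<exists>n::nat. \<exists>C. C 0 = {\<zero>\<^bsub>M\<^esub>} \<and> C n = carrier M \<and> (\<forall>i\<le>n. submodule (C i) R M) \<and>
      (\<forall>i<n. C i \<subseteq> C (Suc i) \<and>
        simple_module R (quot_module (M\<lparr>carrier := C (Suc i)\<rparr>) (C i))))"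

definition artinian_module :: "('a, 'x) ring_scheme \<Rightarrow> ('a, 'm, 'z) module_scheme \<Rightarrow> bool"
  where "artinian_module R M \<longleftrightarrow>
    (\<forall>F :: nat \<Rightarrow> 'm set. (\<forall>i. submodule (F i) R M) \<and> antimono F \<longrightarrow> (\<exists>n. \<forall>m\<ge>n. F m = F n))"

definition socle :: "('a, 'x) ring_scheme \<Rightarrow> ('a, 'm, 'z) module_scheme \<Rightarrow> 'm set"
  where "socle R M =
    mod_span R M (\<Union>{H. submodule H R M \<and> simple_module R (M\<lparr>carrier := H\<rparr>)})"

definition maximal_submodule ::
    "'m set \<Rightarrow> ('a, 'x) ring_scheme \<Rightarrow> ('a, 'm, 'z) module_scheme \<Rightarrow> bool"
  where "maximal_submodule H R M \<longleftrightarrow>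
    submodule H R M \<and> H \<noteq> carrier M \<and>
    (\<forall>L. submodule L R M \<and> H \<subseteq> L \<longrightarrow> L = H \<or> L = carrier M)"

definition jacobson :: "('a, 'z) ring_scheme \<Rightarrow> 'a set"
  where "jacobson R = carrier R \<inter> \<Inter>{I. maximal_submodule I R (regular R)}"

definition frobenius_ring :: "('a, 'z) ring_scheme \<Rightarrow> bool"
  where "frobenius_ring R \<longleftrightarrow>
    ring R \<and> artinian_module R (regular R) \<and> artinian_module (opp R) (regular (opp R)) \<and>
    mod_iso R ((regular R)\<lparr>carrier := socle R (regular R)\<rparr>)
      (quot_module (regular R) (jacobson R)) \<and>
    mod_iso (opp R) ((regular (opp R))\<lparr>carrier := socle (opp R) (regular (opp R))\<rparr>)
      (quot_module (regular (opp R)) (jacobson R))"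

text \<open>The locale \<^locale>\<open>algebra\<close> covers commutative algebras only.\<close>

locale assoc_algebra = module + ring M +
  assumes smult_assoc2:
      "\<lbrakk>a \<in> carrier R; x \<in> carrier M; y \<in> carrier M\<rbrakk> \<Longrightarrow>
      (a \<odot>\<^bsub>M\<^esub> x) \<otimes>\<^bsub>M\<^esub> y = a \<odot>\<^bsub>M\<^esub> (x \<otimes>\<^bsub>M\<^esub> y)"
    and smult_assoc3:
      "\<lbrakk>a \<in> carrier R; x \<in> carrier M; y \<in> carrier M\<rbrakk> \<Longrightarrow>
      x \<otimes>\<^bsub>M\<^esub> (a \<odot>\<^bsub>M\<^esub> y) = a \<odot>\<^bsub>M\<^esub> (x \<otimes>\<^bsub>M\<^esub> y)"

definition frobenius_form ::
    "('k, 'x) ring_scheme \<Rightarrow> ('k, 'a, 'y) module_scheme \<Rightarrow> ('a \<Rightarrow> 'a \<Rightarrow> 'k) \<Rightarrow> bool"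
  where "frobenius_form K A \<phi> \<longleftrightarrow>
    (\<forall>a\<in>carrier A. \<forall>b\<in>carrier A. \<phi> a b \<in> carrier K) \<and>
    (\<forall>a\<in>carrier A. \<forall>b\<in>carrier A. \<forall>c\<in>carrier A.
      \<phi> (a \<oplus>\<^bsub>A\<^esub> b) c = \<phi> a c \<oplus>\<^bsub>K\<^esub> \<phi> b c \<and> \<phi> a (b \<oplus>\<^bsub>A\<^esub> c) = \<phi> a b \<oplus>\<^bsub>K\<^esub> \<phi> a c) \<and>
    (\<forall>k\<in>carrier K. \<forall>a\<in>carrier A. \<forall>b\<in>carrier A.
      \<phi> (k \<odot>\<^bsub>A\<^esub> a) b = k \<otimes>\<^bsub>K\<^esub> \<phi> a b \<and> \<phi> a (k \<odot>\<^bsub>A\<^esub> b) = k \<otimes>\<^bsub>K\<^esub> \<phi> a b) \<and>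
    (\<forall>a\<in>carrier A. \<forall>b\<in>carrier A. \<forall>c\<in>carrier A. \<phi> (a \<otimes>\<^bsub>A\<^esub> b) c = \<phi> a (b \<otimes>\<^bsub>A\<^esub> c)) \<and>
    (\<forall>a\<in>carrier A. (\<forall>b\<in>carrier A. \<phi> a b = \<zero>\<^bsub>K\<^esub>) \<longrightarrow> a = \<zero>\<^bsub>A\<^esub>) \<and>
    (\<forall>a\<in>carrier A. (\<forall>b\<in>carrier A. \<phi> b a = \<zero>\<^bsub>K\<^esub>) \<longrightarrow> a = \<zero>\<^bsub>A\<^esub>)"

definition nonproj_frobenius_algebra ::
    "('k, 'x) ring_scheme \<Rightarrow> ('k, 'a, 'y) module_scheme \<Rightarrow> bool"
  where "nonproj_frobenius_algebra K A \<longleftrightarrow>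
    cring K \<and> frobenius_ring K \<and> assoc_algebra K A \<and> fin_gen K A \<and> (\<exists>\<phi>. frobenius_form K A \<phi>)"

definition frobenius_functional ::
    "('k, 'x) ring_scheme \<Rightarrow> ('k, 'a, 'y) module_scheme \<Rightarrow> ('a \<Rightarrow> 'k) \<Rightarrow> bool"
  where "frobenius_functional K A \<epsilon> \<longleftrightarrow>
    (\<exists>\<phi>. frobenius_form K A \<phi> \<and> (\<forall>a\<in>carrier A. \<epsilon> a = \<phi> \<one>\<^bsub>A\<^esub> a \<and> \<epsilon> a = \<phi> a \<one>\<^bsub>A\<^esub>))"

definition bilinear_form ::
    "('a, 'x) ring_scheme \<Rightarrow> ('a, 'm, 'y) module_scheme \<Rightarrow> ('b, 'a, 'n, 'z) bimodule_scheme \<Rightarrow>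
     ('m \<Rightarrow> 'n \<Rightarrow> 'a) \<Rightarrow> bool"
  where "bilinear_form A M N \<beta> \<longleftrightarrow>
    (\<forall>m\<in>carrier M. \<forall>n\<in>carrier N. \<beta> m n \<in> carrier A) \<and>
    (\<forall>m\<in>carrier M. \<forall>m'\<in>carrier M. \<forall>n\<in>carrier N. \<beta> (m \<oplus>\<^bsub>M\<^esub> m') n = \<beta> m n \<oplus>\<^bsub>A\<^esub> \<beta> m' n) \<and>
    (\<forall>m\<in>carrier M. \<forall>n\<in>carrier N. \<forall>n'\<in>carrier N. \<beta> m (n \<oplus>\<^bsub>N\<^esub> n') = \<beta> m n \<oplus>\<^bsub>A\<^esub> \<beta> m n') \<and>
    (\<forall>a\<in>carrier A. \<forall>a'\<in>carrier A. \<forall>m\<in>carrier M. \<forall>n\<in>carrier N.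
      \<beta> (a \<odot>\<^bsub>M\<^esub> m) (n \<lhd>\<^bsub>N\<^esub> a') = a \<otimes>\<^bsub>A\<^esub> \<beta> m n \<otimes>\<^bsub>A\<^esub> a')"

text \<open>
  The two maps are those from \<open>M\<close> to the dual of \<open>N\<close> and from \<open>N\<close> to the dual of \<open>M\<close>; homomorphisms
  are represented as functions restricted to the carrier of their domain, so that equality of
  homomorphisms is equality in HOL.
\<close>

definition nondegenerate ::
    "('m, 'y) ring_scheme \<Rightarrow> ('n, 'z) ring_scheme \<Rightarrow> ('m \<Rightarrow> 'n \<Rightarrow> 'a) \<Rightarrow> bool"
  where "nondegenerate M N \<beta> \<longleftrightarrow>
    inj_on (\<lambda>m. \<lambda>n\<in>carrier N. \<beta> m n) (carrier M) \<and>
    inj_on (\<lambda>n. \<lambda>m\<in>carrier M. \<beta> m n) (carrier N)"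

definition left_orth ::
    "('a, 'x) ring_scheme \<Rightarrow> ('m, 'y) ring_scheme \<Rightarrow> ('m \<Rightarrow> 'n \<Rightarrow> 'a) \<Rightarrow> 'n set \<Rightarrow> 'm set"
  where "left_orth R M \<beta> S = {m \<in> carrier M. \<forall>s\<in>S. \<beta> m s = \<zero>\<^bsub>R\<^esub>}"

definition right_orth ::
    "('a, 'x) ring_scheme \<Rightarrow> ('n, 'y) ring_scheme \<Rightarrow> ('m \<Rightarrow> 'n \<Rightarrow> 'a) \<Rightarrow> 'm set \<Rightarrow> 'n set"
  where "right_orth R N \<beta> T = {n \<in> carrier N. \<forall>t\<in>T. \<beta> t n = \<zero>\<^bsub>R\<^esub>}"

end

theory Submission
  imports Defs
begin

text \<open>
  Zero is equal to its double orthogonal. If \<open>U \<subseteq> W\<close> with \<open>W / U\<close> simple and \<open>U\<close> is equal to its double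
  orthogonal, so is \<open>W\<close>, provided that every homomorphism \<open>Rx \<rightarrow> R\<close> from a simple left ideal
  is a right multiplication, and likewise on the other side. Ascending a composition series intersected
  with \<open>T\<close> gives the claim for all submodules \<open>T\<close> of a module of finite length; no count of lengths is
  needed.

  For \<open>K\<close> the extension property follows from the isomorphism of its socle with \<open>K / J\<close>. It passes to
  \<open>A\<close> by applying the double orthogonal argument to the form of \<open>A\<close> over \<open>K\<close>: a simple left
  ideal \<open>Ax\<close> is killed by a maximal ideal of \<open>K\<close>, so \<open>xA\<close> is a finite dimensional space over a
  residue field and equals its double orthogonal; this says exactly that \<open>y \<in> xA\<close> as
  soon as the left annihilator of \<open>x\<close> kills \<open>y\<close>.
\<close>

section \<open>Opposite rings and the fields of regular modules\<close>

lemma carrier_opp [simp]: "carrier (opp R) = carrier R"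
  and add_opp [simp]: "add (opp R) = add R"
  and zero_opp [simp]: "\<zero>\<^bsub>opp R\<^esub> = \<zero>\<^bsub>R\<^esub>"
  and one_opp [simp]: "\<one>\<^bsub>opp R\<^esub> = \<one>\<^bsub>R\<^esub>"
  and mult_opp [simp]: "x \<otimes>\<^bsub>opp R\<^esub> y = y \<otimes>\<^bsub>R\<^esub> x"
  and opp_opp [simp]: "opp (opp R) = R"
  by (simp_all add: opp_def)

lemma smult_opp [simp]: "smult (opp A) = smult A"
  by (simp add: opp_def)

lemma abelian_group_opp: "abelian_group R \<Longrightarrow> abelian_group (opp R)"
  by (simp add: abelian_group_def abelian_monoid_def abelian_group_axioms_def)

lemma ring_opp:
  assumes "ring R"
  shows "ring (opp R)"
proof -
  interpret ring R by fact
  show ?thesis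
    by (intro ringI abelian_group_opp is_abelian_group monoidI) (simp_all add: m_assoc l_distr r_distr)
qed

lemma carrier_regular [simp]: "carrier (regular R) = carrier R"
  and add_regular [simp]: "add (regular R) = add R"
  and zero_regular [simp]: "\<zero>\<^bsub>regular R\<^esub> = \<zero>\<^bsub>R\<^esub>"
  and smult_regular [simp]: "smult (regular R) = mult R"
  by (simp_all add: regular_def)

section \<open>Modules over a possibly noncommutative ring: submodules, cosets, simple
  quotients\<close>

context left_module
begin

lemma smult_l_null [simp]:
  assumes "x \<in> carrier M"
  shows "\<zero>\<^bsub>R\<^esub> \<odot> x = \<zero>"
proof -
  have "\<zero>\<^bsub>R\<^esub> \<odot> x \<oplus> \<zero>\<^bsub>R\<^esub> \<odot> x = \<zero>\<^bsub>R\<^esub> \<odot> x"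
    using assms by (simp flip: smult_l_distr)
  then show ?thesis
    using assms M.add.l_cancel_one by simp
qed

lemma smult_r_null [simp]:
  assumes "a \<in> carrier R"
  shows "a \<odot> \<zero> = \<zero>"
proof -
  have "a \<odot> \<zero> \<oplus> a \<odot> \<zero> = a \<odot> \<zero>"
    using assms by (simp flip: smult_r_distr)
  then show ?thesis
    using assms M.add.l_cancel_one by simp
qed

lemma smult_l_minus:
  assumes "a \<in> carrier R" "x \<in> carrier M"
  shows "(\<ominus>\<^bsub>R\<^esub> a) \<odot> x = \<ominus> (a \<odot> x)"
proof -
  have "(\<ominus>\<^bsub>R\<^esub> a) \<odot> x \<oplus> a \<odot> x = \<zero>"
    using assms by (simp add: R.l_neg flip: smult_l_distr)
  then show ?thesis
    using assms by (simp add: M.minus_equality)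
qed

text \<open>Negation is the action of the scalar -1, so closure under additive inverses follows from
  closure under scalars.\<close>

lemma submodule_iff:
  "submodule H R M \<longleftrightarrow> H \<subseteq> carrier M \<and> \<zero> \<in> H \<and> (\<forall>x\<in>H. \<forall>y\<in>H. x \<oplus> y \<in> H) \<and>
    (\<forall>a\<in>carrier R. \<forall>x\<in>H. a \<odot> x \<in> H)" (is "_ \<longleftrightarrow> ?P")
proof
  assume "submodule H R M"
  then interpret submodule H R M .
  show ?P using subset one_closed m_closed by simp
next
  assume P: ?P
  have "\<ominus> x \<in> H" if "x \<in> H" for x
  proof -
    have "\<ominus> x = (\<ominus>\<^bsub>R\<^esub> \<one>\<^bsub>R\<^esub>) \<odot> x"
      using P that by (subst smult_l_minus) auto
    then show ?thesis using P that by auto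
  qed
  with P show "submodule H R M"
    by unfold_locales (auto simp: a_inv_def[symmetric])
qed

lemma submoduleD:
  assumes "submodule H R M"
  shows "H \<subseteq> carrier M" "\<zero> \<in> H" "\<And>x y. \<lbrakk>x \<in> H; y \<in> H\<rbrakk> \<Longrightarrow> x \<oplus> y \<in> H"
    "\<And>a x. \<lbrakk>a \<in> carrier R; x \<in> H\<rbrakk> \<Longrightarrow> a \<odot> x \<in> H" "\<And>x. x \<in> H \<Longrightarrow> \<ominus> x \<in> H"
proof -
  show "\<ominus> x \<in> H" if "x \<in> H" for x
    using submodule.axioms(1)[OF assms] that subgroup.m_inv_closed
    by (fastforce simp: a_inv_def)
qed (use assms submodule_iff in auto)

lemma minus_mem_submodule:
  "\<lbrakk>submodule H R M; x \<in> H; y \<in> H\<rbrakk> \<Longrightarrow> x \<ominus> y \<in> H"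
  by (simp add: a_minus_def submoduleD)

lemma left_module_submodule:
  assumes "submodule H R M"
  shows "left_module R (M\<lparr>carrier := H\<rparr>)"
proof -
  note H = submoduleD[OF assms]
  note [simp] = H(1)[THEN subsetD]
  have "abelian_group (M\<lparr>carrier := H\<rparr>)"
  proof (rule abelian_groupI)
    show "\<exists>y\<in>carrier (M\<lparr>carrier := H\<rparr>). y \<oplus>\<^bsub>M\<lparr>carrier := H\<rparr>\<^esub> x = \<zero>\<^bsub>M\<lparr>carrier := H\<rparr>\<^esub>"
      if "x \<in> carrier (M\<lparr>carrier := H\<rparr>)" for x
      using that H(5)[of x] M.l_neg[of x] by auto
  qed (use H in \<open>auto simp: M.a_ac\<close>)
  then show ?thesis
    by (intro left_module.intro left_module_axioms.intro R.ring_axioms)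
       (simp_all add: H(4) smult_l_distr smult_r_distr smult_assoc1)
qed

lemma a_r_coset_eq_iff:
  assumes "submodule H R M" "x \<in> carrier M" "y \<in> carrier M"
  shows "H +> x = H +> y \<longleftrightarrow> x \<ominus> y \<in> H"
proof -
  interpret abelian_subgroup H M
    using submodule.axioms(1)[OF assms(1)]
    by (intro abelian_subgroupI3 additive_subgroupI M.abelian_group_axioms)
  have "H +> x = H +> y \<longleftrightarrow> x \<in> H +> y"
    using a_rcos_self[OF assms(2)] a_repr_independence'[OF _ assms(3)] by auto
  then show ?thesis
    using a_rcos_module[OF assms(3,2)] by (simp add: a_minus_def)
qed

text \<open>The action on \<open>quot_module\<close> is a union over all representatives. Changing a
  representative by \<open>h\<close> in \<open>H\<close> changes its multiple by
  \<open>a \<odot> h\<close>, again in \<open>H\<close>, so all cosets in the union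
  coincide.\<close>

lemma quot_smult:
  assumes "submodule H R M" "x \<in> carrier M" "a \<in> carrier R"
  shows "a \<odot>\<^bsub>quot_module M H\<^esub> (H +> x) = H +> (a \<odot> x)"
proof -
  note H = submoduleD[OF assms(1)]
  note [simp] = H(1)[THEN subsetD]
  have "H +> (a \<odot> (h \<oplus> x)) = H +> (a \<odot> x)" if "h \<in> H" for h
  proof -
    have "a \<odot> (h \<oplus> x) \<ominus> a \<odot> x = a \<odot> h"
      using that assms by (simp add: smult_r_distr a_minus_def M.a_assoc M.r_neg)
    then show ?thesis
      using that assms H by (subst a_r_coset_eq_iff) auto
  qed
  then have "H +> (a \<odot> y) = H +> (a \<odot> x)" if "y \<in> H +> x" for y
    using that by (auto simp: a_r_coset_def'[of _ H x])
  moreover have "H +> x \<noteq> {}" using H(2) by (auto simp: a_r_coset_def')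
  ultimately show ?thesis
    unfolding quot_module_def module.simps by (intro SUP_eq_const)
qed

lemma quot_add:
  assumes "submodule H R M" "x \<in> carrier M" "y \<in> carrier M"
  shows "(H +> x) \<oplus>\<^bsub>quot_module M H\<^esub> (H +> y) = H +> (x \<oplus> y)"
proof -
  interpret abelian_subgroup H M
    using submodule.axioms(1)[OF assms(1)]
    by (intro abelian_subgroupI3 additive_subgroupI M.abelian_group_axioms)
  show ?thesis using a_rcos_sum[OF assms(2,3)] by (simp add: quot_module_def)
qed

lemma coset_zero_iff:
  assumes "submodule H R M" "x \<in> carrier M"
  shows "H +> x = H \<longleftrightarrow> x \<in> H"
proof -
  have "H +> \<zero> = H" using M.a_coset_add_zero submoduleD(1)[OF assms(1)] by blast
  moreover have "x \<ominus> \<zero> = x" using assms(2) unfolding a_minus_def M.add.inv_one by simp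
  ultimately show ?thesis using a_r_coset_eq_iff[OF assms M.zero_closed] by metis
qed

text \<open>The cosets of the multiples of \<open>w\<close> form a submodule of the quotient; it
  contains the nonzero coset of \<open>w\<close>, so simplicity makes it everything. The double
  orthogonal argument uses simplicity in this elementwise form.\<close>

lemma simple_quotient_generated:
  assumes U: "submodule U R M" and simple: "simple_module R (quot_module M U)"
    and w: "w \<in> carrier M" "w \<notin> U" and w': "w' \<in> carrier M"
  shows "\<exists>a\<in>carrier R. \<exists>u\<in>U. w' = a \<odot> w \<oplus> u"
proof -
  let ?Q = "quot_module M U"
  interpret Q: left_module R ?Q
    using simple by (simp add: simple_module_def)
  let ?H = "(\<lambda>a. U +> (a \<odot> w)) ` carrier R"
  have zero: "U +> (\<zero>\<^bsub>R\<^esub> \<odot> w) = U"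
    using U w by (simp add: submoduleD(1))
  have carrier: "carrier ?Q = (\<lambda>x. U +> x) ` carrier M"
    by (auto simp: quot_module_def A_RCOSETS_def')
  have "submodule ?H R ?Q"
    unfolding Q.submodule_iff
  proof (intro conjI ballI)
    show "?H \<subseteq> carrier ?Q" using w by (auto simp: carrier)
    show "\<zero>\<^bsub>?Q\<^esub> \<in> ?H"
      using zero by (force simp: quot_module_def)
    show "X \<oplus>\<^bsub>?Q\<^esub> Y \<in> ?H" if "X \<in> ?H" "Y \<in> ?H" for X Y
      using that U w by (force simp: quot_add simp flip: smult_l_distr)
    show "a \<odot>\<^bsub>?Q\<^esub> X \<in> ?H" if "a \<in> carrier R" "X \<in> ?H" for a X
      using that U w by (force simp: quot_smult simp flip: smult_assoc1)
  qed
  moreover have "?H \<noteq> {\<zero>\<^bsub>?Q\<^esub>}"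
  proof
    assume "?H = {\<zero>\<^bsub>?Q\<^esub>}"
    then have "U +> (\<one>\<^bsub>R\<^esub> \<odot> w) = U"
      by (metis (no_types, lifting) R.one_closed imageI quot_module_def ring.select_convs(1) singletonD)
    with w U show False by (simp add: coset_zero_iff)
  qed
  ultimately have "?H = carrier ?Q"
    using simple by (auto simp: simple_module_def)
  then obtain a where a: "a \<in> carrier R" "U +> w' = U +> (a \<odot> w)"
    using w' unfolding carrier by blast
  then have "w' \<ominus> a \<odot> w \<in> U"
    using U w w' by (subst (asm) a_r_coset_eq_iff) auto
  moreover have "w' = a \<odot> w \<oplus> (w' \<ominus> a \<odot> w)"
    using a w w' by (simp add: a_minus_def M.a_ac M.r_neg)
  ultimately show ?thesis using a by blast
qed

end

section \<open>The regular module and generators of simple left ideals\<close>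

lemma (in ring) left_module_regular: "left_module R (regular R)"
proof -
  have "abelian_group (regular R)"
    by (rule abelian_groupI) (auto simp: a_ac intro: bexI[of _ "\<ominus> _"] l_neg)
  then show ?thesis
    by (intro left_module.intro left_module_axioms.intro ring_axioms)
       (simp_all add: l_distr r_distr m_assoc)
qed

text \<open>\<open>minimal_element R x\<close> says that \<open>Rx\<close> is a simple left ideal; \<open>minimal_injective R\<close> that homomorphisms
  from such ideals to \<open>R\<close> are right multiplications.\<close>

definition minimal_element :: "('a, 'z) ring_scheme \<Rightarrow> 'a \<Rightarrow> bool"
  where "minimal_element R x \<longleftrightarrow> x \<in> carrier R \<and> x \<noteq> \<zero>\<^bsub>R\<^esub> \<and>
    (\<forall>c\<in>carrier R. c \<otimes>\<^bsub>R\<^esub> x \<noteq> \<zero>\<^bsub>R\<^esub> \<longrightarrow> (\<exists>d\<in>carrier R. d \<otimes>\<^bsub>R\<^esub> (c \<otimes>\<^bsub>R\<^esub> x) = x))"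

definition minimal_injective :: "('a, 'z) ring_scheme \<Rightarrow> bool"
  where "minimal_injective R \<longleftrightarrow> (\<forall>x y. minimal_element R x \<and> y \<in> carrier R \<and>
    (\<forall>c\<in>carrier R. c \<otimes>\<^bsub>R\<^esub> x = \<zero>\<^bsub>R\<^esub> \<longrightarrow> c \<otimes>\<^bsub>R\<^esub> y = \<zero>\<^bsub>R\<^esub>) \<longrightarrow> (\<exists>a\<in>carrier R. y = x \<otimes>\<^bsub>R\<^esub> a))"

lemma minimal_injectiveD:
  assumes "minimal_injective R" "minimal_element R x" "y \<in> carrier R"
    "\<And>c. \<lbrakk>c \<in> carrier R; c \<otimes>\<^bsub>R\<^esub> x = \<zero>\<^bsub>R\<^esub>\<rbrakk> \<Longrightarrow> c \<otimes>\<^bsub>R\<^esub> y = \<zero>\<^bsub>R\<^esub>"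
  obtains a where "a \<in> carrier R" "y = x \<otimes>\<^bsub>R\<^esub> a"
  using assms unfolding minimal_injective_def by blast

text \<open>Right multiplication by \<open>b\<close> is left linear on the simple left ideal Rx and
  nonzero at \<open>x\<close>, hence injective on Rx. Its image is again simple, and its generator
  has the same left annihilator as \<open>x\<close>.\<close>

lemma (in ring) minimal_element_mult:
  assumes x: "minimal_element R x" and b: "b \<in> carrier R" "x \<otimes> b \<noteq> \<zero>"
  shows "minimal_element R (x \<otimes> b)"
    and "\<lbrakk>c \<in> carrier R; c \<otimes> (x \<otimes> b) = \<zero>\<rbrakk> \<Longrightarrow> c \<otimes> x = \<zero>"
proof -
  have [simp]: "x \<in> carrier R" using x by (simp add: minimal_element_def)
  have d: "\<exists>d\<in>carrier R. d \<otimes> (c \<otimes> (x \<otimes> b)) = x \<otimes> b" if "c \<in> carrier R" "c \<otimes> x \<noteq> \<zero>" for c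
  proof -
    from x that obtain d where "d \<in> carrier R" "d \<otimes> (c \<otimes> x) = x"
      by (auto simp: minimal_element_def)
    with that b show ?thesis by (metis \<open>x \<in> carrier R\<close> m_assoc m_closed)
  qed
  show "minimal_element R (x \<otimes> b)"
    unfolding minimal_element_def
  proof (intro conjI ballI impI)
    fix c assume c: "c \<in> carrier R" "c \<otimes> (x \<otimes> b) \<noteq> \<zero>"
    then have "c \<otimes> x \<noteq> \<zero>" using b by (auto simp flip: m_assoc)
    with d c show "\<exists>d\<in>carrier R. d \<otimes> (c \<otimes> (x \<otimes> b)) = x \<otimes> b" by blast
  qed (use b in auto)
  show "c \<otimes> x = \<zero>" if "c \<in> carrier R" "c \<otimes> (x \<otimes> b) = \<zero>"
    using d[OF that(1)] that b by auto
qed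

text \<open>If xb is nonzero, whatever annihilates xb from the left annihilates \<open>x\<close>.
  The extension property at the minimal element xb then gives x = xba, so the right ideal xR is
  simple too.\<close>

lemma (in ring) minimal_element_opp:
  assumes R: "minimal_injective R" and x: "minimal_element R x"
  shows "minimal_element (opp R) x"
proof -
  have [simp]: "x \<in> carrier R" "x \<noteq> \<zero>" using x by (auto simp add: minimal_element_def)
  have "\<exists>d\<in>carrier R. x \<otimes> b \<otimes> d = x" if b: "b \<in> carrier R" "x \<otimes> b \<noteq> \<zero>" for b
  proof -
    obtain a where "a \<in> carrier R" "x = x \<otimes> b \<otimes> a"
    proof (rule minimal_injectiveD[OF R minimal_element_mult(1)[OF x b], of x])
      show "c \<otimes> x = \<zero>" if "c \<in> carrier R" "c \<otimes> (x \<otimes> b) = \<zero>" for c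
        using minimal_element_mult(2)[OF x b that] .
    qed auto
    then show ?thesis by metis
  qed
  then show ?thesis by (auto simp: minimal_element_def)
qed

section \<open>Nondegenerate pairings and double orthogonals\<close>

text \<open>Serves two situations: the Frobenius form, with ring \<open>K\<close> and the algebra
  \<open>A\<close> on both sides, and the given form between \<open>M\<close> and \<open>N\<close>
  over \<open>A\<close>.\<close>

locale pairing = left: left_module R M + right: left_module "opp R" N
  for R :: "('a, 'y) ring_scheme" (structure) and M :: "('a, 'm, 'z) module_scheme"
    and N :: "('a, 'n, 'w) module_scheme" +
  fixes \<beta> :: "'m \<Rightarrow> 'n \<Rightarrow> 'a"
  assumes form_closed [simp]: "\<lbrakk>m \<in> carrier M; n \<in> carrier N\<rbrakk> \<Longrightarrow> \<beta> m n \<in> carrier R"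
    and form_add_left: "\<lbrakk>m \<in> carrier M; m' \<in> carrier M; n \<in> carrier N\<rbrakk>
      \<Longrightarrow> \<beta> (m \<oplus>\<^bsub>M\<^esub> m') n = \<beta> m n \<oplus> \<beta> m' n"
    and form_add_right: "\<lbrakk>m \<in> carrier M; n \<in> carrier N; n' \<in> carrier N\<rbrakk>
      \<Longrightarrow> \<beta> m (n \<oplus>\<^bsub>N\<^esub> n') = \<beta> m n \<oplus> \<beta> m n'"
    and form_smult_left: "\<lbrakk>a \<in> carrier R; m \<in> carrier M; n \<in> carrier N\<rbrakk>
      \<Longrightarrow> \<beta> (a \<odot>\<^bsub>M\<^esub> m) n = a \<otimes> \<beta> m n"
    and form_smult_right: "\<lbrakk>a \<in> carrier R; m \<in> carrier M; n \<in> carrier N\<rbrakk>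
      \<Longrightarrow> \<beta> m (a \<odot>\<^bsub>N\<^esub> n) = \<beta> m n \<otimes> a"
    and left_nondegenerate: "\<lbrakk>m \<in> carrier M; \<And>n. n \<in> carrier N \<Longrightarrow> \<beta> m n = \<zero>\<rbrakk> \<Longrightarrow> m = \<zero>\<^bsub>M\<^esub>"
    and right_nondegenerate: "\<lbrakk>n \<in> carrier N; \<And>m. m \<in> carrier M \<Longrightarrow> \<beta> m n = \<zero>\<rbrakk> \<Longrightarrow> n = \<zero>\<^bsub>N\<^esub>"
begin

text \<open>Mirror symmetry: results about \<open>M\<close> transfer to \<open>N\<close>, as in
  \<open>form_minus_right\<close> and for the submodule \<open>S\<close> of the theorem.\<close>

lemma opposite: "pairing (opp R) N M (\<lambda>n m. \<beta> m n)"
proof (intro pairing.intro pairing_axioms.intro)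
  show "left_module (opp R) N" "left_module (opp (opp R)) M"
    by (simp_all only: opp_opp left.left_module_axioms right.left_module_axioms)
  show "n = \<zero>\<^bsub>N\<^esub>" if "n \<in> carrier N" "\<And>m. m \<in> carrier M \<Longrightarrow> \<beta> m n = \<zero>\<^bsub>opp R\<^esub>" for n
    using that right_nondegenerate by simp
  show "m = \<zero>\<^bsub>M\<^esub>" if "m \<in> carrier M" "\<And>n. n \<in> carrier N \<Longrightarrow> \<beta> m n = \<zero>\<^bsub>opp R\<^esub>" for m
    using that left_nondegenerate by simp
qed (simp_all add: form_add_left form_add_right form_smult_left form_smult_right)

lemma form_zero_left [simp]: "n \<in> carrier N \<Longrightarrow> \<beta> \<zero>\<^bsub>M\<^esub> n = \<zero>"
  using form_smult_left[of "\<zero>" "\<zero>\<^bsub>M\<^esub>" n] by simp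

lemma form_zero_right [simp]: "m \<in> carrier M \<Longrightarrow> \<beta> m \<zero>\<^bsub>N\<^esub> = \<zero>"
  using form_smult_right[of "\<zero>" m "\<zero>\<^bsub>N\<^esub>"] right.smult_r_null[of \<zero>] by simp

lemma form_minus_left:
  assumes "m \<in> carrier M" "m' \<in> carrier M" "n \<in> carrier N"
  shows "\<beta> (m \<ominus>\<^bsub>M\<^esub> m') n = \<beta> m n \<oplus> \<ominus> \<beta> m' n"
proof -
  have "\<beta> (\<ominus>\<^bsub>M\<^esub> m') n = \<ominus> \<beta> m' n"
    using form_smult_left[of "\<ominus> \<one>" m' n] assms
    by (simp add: left.smult_l_minus left.R.l_minus)
  then show ?thesis
    using assms by (simp add: a_minus_def form_add_left)
qed

lemma form_minus_right:
  assumes "m \<in> carrier M" "n \<in> carrier N" "n' \<in> carrier N"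
  shows "\<beta> m (n \<ominus>\<^bsub>N\<^esub> n') = \<beta> m n \<oplus> \<ominus> \<beta> m n'"
  using pairing.form_minus_left[OF opposite, of n n' m] assms
  by (simp add: a_minus_def a_inv_def)

lemma submodule_left_orth:
  assumes "S \<subseteq> carrier N"
  shows "submodule (left_orth R M \<beta> S) R M"
  unfolding left.submodule_iff left_orth_def
  using assms by (auto simp: form_add_left form_smult_left subset_iff)

lemma submodule_right_orth:
  assumes "T \<subseteq> carrier M"
  shows "submodule (right_orth R N \<beta> T) (opp R) N"
  unfolding right.submodule_iff right_orth_def
  using assms by (auto simp: form_add_right form_smult_right subset_iff)

lemma double_orth_supset:
  assumes "T \<subseteq> carrier M"
  shows "T \<subseteq> left_orth R M \<beta> (right_orth R N \<beta> T)"
  using assms by (auto simp: left_orth_def right_orth_def)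

lemma double_orth_zero: "left_orth R M \<beta> (right_orth R N \<beta> {\<zero>\<^bsub>M\<^esub>}) = {\<zero>\<^bsub>M\<^esub>}"
  by (auto simp: left_orth_def right_orth_def intro: left_nondegenerate)

text \<open>An \<open>n0\<close> that kills \<open>U\<close> but not \<open>w\<close> carries W/U
  onto the simple left ideal generated by \<open>x = \<beta> w n0\<close>. For \<open>m\<close> in
  the double orthogonal of \<open>W\<close>, the extension properties on both sides yield an
  \<open>a\<close> such that \<open>m\<close> and aw pair equally with everything orthogonal to
  \<open>U\<close>. Hence m - aw lies in the double orthogonal of \<open>U\<close>, which is
  \<open>U\<close>.\<close>

lemma double_orth_step:
  assumes inj: "minimal_injective R" "minimal_injective (opp R)"
    and U: "submodule U R M" "left_orth R M \<beta> (right_orth R N \<beta> U) = U"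
    and W: "submodule W R M" "U \<subseteq> W"
    and gen: "\<And>w w'. \<lbrakk>w \<in> W; w \<notin> U; w' \<in> W\<rbrakk> \<Longrightarrow> \<exists>a\<in>carrier R. \<exists>u\<in>U. w' = a \<odot>\<^bsub>M\<^esub> w \<oplus>\<^bsub>M\<^esub> u"
  shows "left_orth R M \<beta> (right_orth R N \<beta> W) = W"
proof (cases "W = U")
  case False
  note [simp] = left.submoduleD(1)[OF U(1), THEN subsetD] left.submoduleD(1)[OF W(1), THEN subsetD]
  from False W obtain w where w: "w \<in> W" "w \<notin> U" by blast
  \<comment> \<open>As \<open>U\<close> equals its double orthogonal, \<open>w\<close> outside
    \<open>U\<close> is detected by some element orthogonal to \<open>U\<close>.\<close>
  obtain n0 where n0: "n0 \<in> carrier N" "\<And>u. u \<in> U \<Longrightarrow> \<beta> u n0 = \<zero>" "\<beta> w n0 \<noteq> \<zero>"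
  proof -
    have "w \<notin> left_orth R M \<beta> (right_orth R N \<beta> U)" using w U(2) by simp
    moreover have "w \<in> carrier M" using w by simp
    ultimately show ?thesis using that unfolding left_orth_def right_orth_def by blast
  qed
  define x where "x = \<beta> w n0"
  have [simp]: "x \<in> carrier R" using w n0 by (simp add: x_def)
  \<comment> \<open>Pairing with \<open>n0\<close> transports the generation of W/U to the left
    ideal of \<open>x\<close>; the summand in \<open>U\<close> vanishes.\<close>
  have gen_x: "\<exists>d\<in>carrier R. \<exists>u\<in>U. w = d \<odot>\<^bsub>M\<^esub> (c \<odot>\<^bsub>M\<^esub> w) \<oplus>\<^bsub>M\<^esub> u \<and> d \<otimes> (c \<otimes> x) = x"
    if c: "c \<in> carrier R" "c \<odot>\<^bsub>M\<^esub> w \<notin> U" for c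
  proof -
    have "c \<odot>\<^bsub>M\<^esub> w \<in> W" using c w W left.submoduleD(4) by blast
    from gen[OF this c(2) w(1)] obtain d u
      where d: "d \<in> carrier R" "u \<in> U" "w = d \<odot>\<^bsub>M\<^esub> (c \<odot>\<^bsub>M\<^esub> w) \<oplus>\<^bsub>M\<^esub> u" by blast
    then have "x = \<beta> (d \<odot>\<^bsub>M\<^esub> (c \<odot>\<^bsub>M\<^esub> w) \<oplus>\<^bsub>M\<^esub> u) n0"
      unfolding x_def by presburger
    also have "\<dots> = d \<otimes> (c \<otimes> x)"
      using c d(1,2) w n0 by (simp add: form_add_left form_smult_left x_def)
    finally show ?thesis using d by metis
  qed
  have annihilator: "c \<odot>\<^bsub>M\<^esub> w \<in> U" if "c \<in> carrier R" "c \<otimes> x = \<zero>" for c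
  proof (rule ccontr)
    assume "c \<odot>\<^bsub>M\<^esub> w \<notin> U"
    with gen_x[OF that(1)] that(2) n0(3) show False by (auto simp: x_def)
  qed
  have minimal: "minimal_element R x"
    unfolding minimal_element_def
  proof (intro conjI ballI impI)
    fix c assume c: "c \<in> carrier R" "c \<otimes> x \<noteq> \<zero>"
    then have "c \<odot>\<^bsub>M\<^esub> w \<notin> U"
      using n0(2)[of "c \<odot>\<^bsub>M\<^esub> w"] w n0(1) by (auto simp: form_smult_left x_def)
    with gen_x[OF c(1)] show "\<exists>d\<in>carrier R. d \<otimes> (c \<otimes> x) = x" by blast
  qed (use n0 w in \<open>auto simp: x_def\<close>)
  have "m \<in> W" if "m \<in> left_orth R M \<beta> (right_orth R N \<beta> W)" for m
  proof -
    have m: "m \<in> carrier M"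
      and m_orth: "\<And>n. \<lbrakk>n \<in> carrier N; \<And>w. w \<in> W \<Longrightarrow> \<beta> w n = \<zero>\<rbrakk> \<Longrightarrow> \<beta> m n = \<zero>"
      using that by (auto simp: left_orth_def right_orth_def)
    have perp: "\<beta> v n = \<zero>"
      if n: "n \<in> carrier N" "\<And>u. u \<in> U \<Longrightarrow> \<beta> u n = \<zero>" "\<beta> w n = \<zero>" and v: "v \<in> W" for n v
    proof -
      from gen[OF w v] obtain a u where au: "a \<in> carrier R" "u \<in> U" "v = a \<odot>\<^bsub>M\<^esub> w \<oplus>\<^bsub>M\<^esub> u" by blast
      then show ?thesis using n w by (simp add: form_add_left form_smult_left)
    qed
    \<comment> \<open>Extension property on the right: if xb = 0, the element n0 b is orthogonal to
      \<open>w\<close> and to \<open>U\<close>, hence to \<open>W\<close>, so \<open>m\<close> kills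
      it as well.\<close>
    obtain a where a: "a \<in> carrier R" "\<beta> m n0 = a \<otimes> x"
    proof (rule minimal_injectiveD[OF inj(2) left.R.minimal_element_opp[OF inj(1) minimal], of "\<beta> m n0"])
      fix b assume "b \<in> carrier (opp R)" "b \<otimes>\<^bsub>opp R\<^esub> x = \<zero>\<^bsub>opp R\<^esub>"
      then have b: "b \<in> carrier R" "x \<otimes> b = \<zero>" by auto
      have "\<beta> m (b \<odot>\<^bsub>N\<^esub> n0) = \<zero>"
      proof (rule m_orth)
        show "\<beta> v (b \<odot>\<^bsub>N\<^esub> n0) = \<zero>" if "v \<in> W" for v
          by (rule perp) (use b n0 w that in \<open>auto simp: form_smult_right x_def\<close>)
      qed (use b n0 in auto)
      then show "b \<otimes>\<^bsub>opp R\<^esub> \<beta> m n0 = \<zero>\<^bsub>opp R\<^esub>"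
        using b n0 m by (simp add: form_smult_right)
    qed (use m n0 in auto)
    have "m \<ominus>\<^bsub>M\<^esub> a \<odot>\<^bsub>M\<^esub> w \<in> left_orth R M \<beta> (right_orth R N \<beta> U)"
      unfolding left_orth_def right_orth_def
    proof (intro CollectI conjI ballI)
      fix n assume "n \<in> {n \<in> carrier N. \<forall>t\<in>U. \<beta> t n = \<zero>}"
      then have n: "n \<in> carrier N" "\<And>u. u \<in> U \<Longrightarrow> \<beta> u n = \<zero>" by auto
      \<comment> \<open>Extension property on the left: if cx = 0, then cw lies in \<open>U\<close>,
        which \<open>n\<close> kills.\<close>
      obtain b where b: "b \<in> carrier R" "\<beta> w n = x \<otimes> b"
      proof (rule minimal_injectiveD[OF inj(1) minimal, of "\<beta> w n"])
        fix c assume c: "c \<in> carrier R" "c \<otimes> x = \<zero>"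
        show "c \<otimes> \<beta> w n = \<zero>"
          using n(2)[OF annihilator[OF c]] c n w by (simp add: form_smult_left)
      qed (use n w in auto)
      \<comment> \<open>Subtracting n0 b removes the value at \<open>w\<close>, so \<open>n'\<close>
        is orthogonal to \<open>W\<close> and is killed by \<open>m\<close>. Thus \<open>m\<close>
        pairs with \<open>n\<close> to axb, and so does aw.\<close>
      define n' where "n' = n \<ominus>\<^bsub>N\<^esub> b \<odot>\<^bsub>N\<^esub> n0"
      have n': "n' \<in> carrier N" "\<beta> w n' = \<zero>" "\<And>u. u \<in> U \<Longrightarrow> \<beta> u n' = \<zero>"
        unfolding n'_def using n n0 b w
        by (auto simp: form_minus_right form_smult_right x_def left.R.r_neg)
      have "\<beta> m n' = \<zero>"
        by (rule m_orth[OF n'(1) perp]) (use n' in simp_all)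
      moreover have "n = n' \<oplus>\<^bsub>N\<^esub> b \<odot>\<^bsub>N\<^esub> n0"
        using n n0 b by (simp add: n'_def a_minus_def right.M.a_assoc right.M.l_neg)
      ultimately show "\<beta> (m \<ominus>\<^bsub>M\<^esub> a \<odot>\<^bsub>M\<^esub> w) n = \<zero>"
        using n' n0 m w a b
        by (simp add: form_minus_left form_add_right form_smult_right form_smult_left
            left.R.m_assoc left.R.r_neg flip: x_def)
    qed (use m a w in auto)
    then have mem: "m \<ominus>\<^bsub>M\<^esub> a \<odot>\<^bsub>M\<^esub> w \<in> W" using U(2) W(2) by auto
    have "m = (m \<ominus>\<^bsub>M\<^esub> a \<odot>\<^bsub>M\<^esub> w) \<oplus>\<^bsub>M\<^esub> a \<odot>\<^bsub>M\<^esub> w"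
      using m a w by (simp add: a_minus_def left.M.a_assoc left.M.l_neg)
    then show "m \<in> W"
      using mem a w left.submoduleD[OF W(1)] by metis
  qed
  then show ?thesis
    using double_orth_supset[of W] left.submoduleD(1)[OF W(1)] by blast
qed (use U in simp)

text \<open>The factors of the chain \<open>T \<inter> C i\<close> embed in the simple factors of
  \<open>C\<close>, so each is zero or simple and \<open>double_orth_step\<close> climbs the
  chain.\<close>

lemma double_orth_finite_length:
  assumes inj: "minimal_injective R" "minimal_injective (opp R)"
    and len: "finite_length R M" and T: "submodule T R M"
  shows "left_orth R M \<beta> (right_orth R N \<beta> T) = T"
proof -
  obtain n :: nat and C where C: "C 0 = {\<zero>\<^bsub>M\<^esub>}" "C n = carrier M"
    "\<And>i. i \<le> n \<Longrightarrow> submodule (C i) R M" "\<And>i. i < n \<Longrightarrow> C i \<subseteq> C (Suc i)"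
    "\<And>i. i < n \<Longrightarrow> simple_module R (quot_module (M\<lparr>carrier := C (Suc i)\<rparr>) (C i))"
    using len unfolding finite_length_def by (elim exE conjE) (simp_all only: Ball_def)
  note T' = left.submoduleD[OF T]
  have sub: "submodule (T \<inter> C i) R M" if "i \<le> n" for i
    using C(3)[OF that] T unfolding left.submodule_iff by blast
  have "left_orth R M \<beta> (right_orth R N \<beta> (T \<inter> C i)) = T \<inter> C i" if "i \<le> n" for i
    using that
  proof (induction i)
    case 0
    have "T \<inter> C 0 = {\<zero>\<^bsub>M\<^esub>}" using C(1) T'(2) by auto
    then show ?case using double_orth_zero by simp
  next
    case (Suc i)
    note Ci = left.submoduleD[OF C(3)[of i]] and CSi = left.submoduleD[OF C(3)[of "Suc i"]]
    interpret S: left_module R "M\<lparr>carrier := C (Suc i)\<rparr>"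
      using Suc.prems C(3) left.left_module_submodule by blast
    have sub_S: "submodule (C i) R (M\<lparr>carrier := C (Suc i)\<rparr>)"
      using Suc.prems C(4)[of i] Ci by (auto simp: S.submodule_iff)
    show ?case
    proof (rule double_orth_step[OF inj])
      fix w w' assume w: "w \<in> T \<inter> C (Suc i)" "w \<notin> T \<inter> C i" "w' \<in> T \<inter> C (Suc i)"
      obtain a u where a: "a \<in> carrier R" "u \<in> C i" "w' = a \<odot>\<^bsub>M\<^esub> w \<oplus>\<^bsub>M\<^esub> u"
        using S.simple_quotient_generated[OF sub_S C(5)[of i], of w w'] Suc.prems w by auto
      have [simp]: "u \<in> carrier M" "w \<in> carrier M" using a w T'(1) Ci(1) Suc.prems by auto
      \<comment> \<open>The remainder in \<open>C i\<close> is a difference of elements of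
        \<open>T\<close>, so it lies in the intersection.\<close>
      have "u = w' \<ominus>\<^bsub>M\<^esub> a \<odot>\<^bsub>M\<^esub> w"
        using a by (simp add: a_minus_def left.M.a_ac left.M.r_neg)
      moreover have "w' \<ominus>\<^bsub>M\<^esub> a \<odot>\<^bsub>M\<^esub> w \<in> T"
        using left.minus_mem_submodule[OF T, of w' "a \<odot>\<^bsub>M\<^esub> w"] T'(4)[OF a(1), of w] w by blast
      ultimately have "u \<in> T" by metis
      with a show "\<exists>a\<in>carrier R. \<exists>u\<in>T \<inter> C i. w' = a \<odot>\<^bsub>M\<^esub> w \<oplus>\<^bsub>M\<^esub> u" by blast
    qed (use Suc sub C(4)[of i] in auto)
  qed
  from this[of n] show ?thesis using C(2) T' by (simp add: Int_absorb2)
qed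

end

section \<open>Commutative rings: the extension property of Frobenius rings, and stable
  powers\<close>

lemma a_inv_regular [simp]: "a_inv (regular R) = a_inv R"
  by (simp add: fun_eq_iff a_inv_def m_inv_def)

lemma (in cring) minimal_injective_opp: "minimal_injective R \<Longrightarrow> minimal_injective (opp R)"
proof -
  have min: "minimal_element (opp R) x \<longleftrightarrow> minimal_element R x" for x
    unfolding minimal_element_def by (auto simp: m_comm)
  assume R: "minimal_injective R"
  show ?thesis
    unfolding minimal_injective_def min
  proof (intro allI impI, elim conjE)
    fix x y
    assume x: "minimal_element R x" and y: "y \<in> carrier (opp R)"
      and ann: "\<forall>c\<in>carrier (opp R). c \<otimes>\<^bsub>opp R\<^esub> x = \<zero>\<^bsub>opp R\<^esub> \<longrightarrow> c \<otimes>\<^bsub>opp R\<^esub> y = \<zero>\<^bsub>opp R\<^esub>"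
    have [simp]: "x \<in> carrier R" using x by (simp add: minimal_element_def)
    obtain a where "a \<in> carrier R" "y = x \<otimes> a"
      by (rule minimal_injectiveD[OF R x, of y]) (use ann y in \<open>simp_all add: m_comm\<close>)
    then show "\<exists>a\<in>carrier (opp R). y = x \<otimes>\<^bsub>opp R\<^esub> a"
      by (intro bexI[of _ a]) (simp_all add: m_comm)
  qed
qed

lemma (in ring) jacobson_submodule: "submodule (jacobson R) R (regular R)"
proof -
  interpret L: left_module R "regular R" by (rule left_module_regular)
  have I: "submodule I R (regular R)" if "maximal_submodule I R (regular R)" for I
    using that by (simp add: maximal_submodule_def)
  show ?thesis
    unfolding L.submodule_iff jacobson_def
    using I[THEN L.submoduleD(2)] I[THEN L.submoduleD(3)] I[THEN L.submoduleD(4)]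
    by (simp add: subset_iff)
qed

text \<open>A nonzero element of a submodule of Rx is a multiple of \<open>x\<close> from which
  minimality recovers \<open>x\<close>. So Rx is simple and contained in the socle.\<close>

lemma (in ring) minimal_element_in_socle:
  assumes x: "minimal_element R x" and c: "c \<in> carrier R"
  shows "c \<otimes> x \<in> socle R (regular R)"
proof -
  interpret L: left_module R "regular R" by (rule left_module_regular)
  have [simp]: "x \<in> carrier R" "x \<noteq> \<zero>" using x by (simp_all add: minimal_element_def)
  define H where "H = (\<lambda>a. a \<otimes> x) ` carrier R"
  have H: "submodule H R (regular R)"
    unfolding L.submodule_iff
  proof (intro conjI ballI)
    show "\<zero>\<^bsub>regular R\<^esub> \<in> H" unfolding H_def by (rule image_eqI[of _ _ \<zero>]) simp_all
    show "u \<oplus>\<^bsub>regular R\<^esub> v \<in> H" if "u \<in> H" "v \<in> H" for u v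
      using that unfolding H_def by (force simp flip: l_distr)
    show "a \<odot>\<^bsub>regular R\<^esub> u \<in> H" if "a \<in> carrier R" "u \<in> H" for a u
      using that unfolding H_def by (force simp flip: m_assoc)
  qed (auto simp: H_def)
  have xH: "x \<in> H" unfolding H_def by (rule image_eqI[of _ _ \<one>]) simp_all
  interpret LH: left_module R "regular R\<lparr>carrier := H\<rparr>"
    by (rule L.left_module_submodule[OF H])
  have "L = {\<zero>} \<or> L = H" if "submodule L R (regular R\<lparr>carrier := H\<rparr>)" for L
  proof (cases "L \<subseteq> {\<zero>}")
    case True
    then show ?thesis using LH.submoduleD(2)[OF that] by auto
  next
    case False
    then obtain u where u: "u \<in> L" "u \<noteq> \<zero>" by blast
    have LH: "L \<subseteq> H" using LH.submoduleD(1)[OF that] by simp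
    with u obtain a where a: "a \<in> carrier R" "u = a \<otimes> x" by (auto simp: H_def)
    with u x obtain d where d: "d \<in> carrier R" "d \<otimes> u = x"
      unfolding minimal_element_def by metis
    then have "x \<in> L" using LH.submoduleD(4)[OF that d(1) u(1)] by simp
    then have "H \<subseteq> L" using LH.submoduleD(4)[OF that, of _ x] by (auto simp: H_def)
    with LH show ?thesis by blast
  qed
  then have "simple_module R (regular R\<lparr>carrier := H\<rparr>)"
    unfolding simple_module_def using LH.left_module_axioms xH by auto
  then have "H \<subseteq> socle R (regular R)"
    unfolding socle_def mod_span_def using H by blast
  then show ?thesis using c by (auto simp: H_def)
qed

text \<open>The left ideal I + Rp is strictly larger than \<open>I\<close>, so it contains
  one.\<close>

lemma (in ring) maximal_left_ideal_comaximal: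
  assumes I: "maximal_submodule I R (regular R)" and p: "p \<in> carrier R" "p \<notin> I"
  shows "\<exists>i\<in>I. \<exists>r\<in>carrier R. \<one> = i \<oplus> r \<otimes> p"
proof -
  interpret L: left_module R "regular R" by (rule left_module_regular)
  have sub: "submodule I R (regular R)" using I by (simp add: maximal_submodule_def)
  note sub' = L.submoduleD[OF sub, simplified]
  note [simp] = sub'(1)[THEN subsetD]
  define H where "H = {i \<oplus> r \<otimes> p | i r. i \<in> I \<and> r \<in> carrier R}"
  have HI: "i \<oplus> r \<otimes> p \<in> H" if "i \<in> I" "r \<in> carrier R" for i r
    using that unfolding H_def by blast
  have "submodule H R (regular R)"
    unfolding L.submodule_iff
  proof (intro conjI ballI)
    show "H \<subseteq> carrier (regular R)" using p by (auto simp: H_def)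
    show "\<zero>\<^bsub>regular R\<^esub> \<in> H" using HI[OF sub'(2) zero_closed] p by simp
    show "u \<oplus>\<^bsub>regular R\<^esub> v \<in> H" if uv: "u \<in> H" "v \<in> H" for u v
    proof -
      obtain i r j s where *: "i \<in> I" "j \<in> I" "r \<in> carrier R" "s \<in> carrier R"
        "u = i \<oplus> r \<otimes> p" "v = j \<oplus> s \<otimes> p"
        using uv unfolding H_def by blast
      have "u \<oplus> v = (i \<oplus> j) \<oplus> (r \<oplus> s) \<otimes> p"
        using * p by (simp add: l_distr a_ac)
      then show ?thesis using HI sub'(3) * by simp
    qed
    show "a \<odot>\<^bsub>regular R\<^esub> u \<in> H" if a: "a \<in> carrier R" and u: "u \<in> H" for a u
    proof -
      obtain i r where *: "i \<in> I" "r \<in> carrier R" "u = i \<oplus> r \<otimes> p"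
        using u unfolding H_def by blast
      have "a \<otimes> u = a \<otimes> i \<oplus> (a \<otimes> r) \<otimes> p"
        using * a p by (simp add: r_distr m_assoc)
      then show ?thesis using HI sub'(4) * a by simp
    qed
  qed
  moreover have "I \<subseteq> H"
  proof
    fix i assume "i \<in> I"
    then show "i \<in> H" using HI[of i \<zero>] p by simp
  qed
  moreover have "p \<in> H" using HI[OF sub'(2) one_closed] p by simp
  ultimately have "H = carrier R"
    using I p unfolding maximal_submodule_def by auto
  then have "\<one> \<in> H" by simp
  then show ?thesis unfolding H_def by blast
qed

text \<open>Let \<open>f\<close> map the socle isomorphically to R/J, with \<open>p\<close>
  representing the image of \<open>x\<close>. A maximal ideal avoiding \<open>p\<close> gives 1 = i
  + rp, where \<open>i\<close> annihilates \<open>x\<close> and hence \<open>y\<close>. If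
  \<open>q\<close> represents the image of \<open>y\<close>, then \<open>q\<close> is congruent to
  rqp modulo \<open>J\<close>, and injectivity of \<open>f\<close> gives y = rqx.\<close>

lemma (in cring) frobenius_minimal_injective:
  assumes "frobenius_ring R"
  shows "minimal_injective R"
  unfolding minimal_injective_def
proof (intro allI impI, elim conjE)
  fix x y
  assume x: "minimal_element R x" and y [simp]: "y \<in> carrier R"
    and ann: "\<forall>c\<in>carrier R. c \<otimes> x = \<zero> \<longrightarrow> c \<otimes> y = \<zero>"
  have [simp]: "x \<in> carrier R" "x \<noteq> \<zero>" using x by (simp_all add: minimal_element_def)
  interpret L: left_module R "regular R" by (rule left_module_regular)
  define J where "J = jacobson R"
  define S where "S = socle R (regular R)"
  have J: "submodule J R (regular R)" unfolding J_def by (rule jacobson_submodule)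
  note J' = L.submoduleD[OF J, simplified]
  obtain f where f: "bij_betw f S (carrier (quot_module (regular R) J))"
    and f_smult: "\<And>a u. \<lbrakk>a \<in> carrier R; u \<in> S\<rbrakk> \<Longrightarrow> f (a \<otimes> u) = a \<odot>\<^bsub>quot_module (regular R) J\<^esub> f u"
    using assms unfolding frobenius_ring_def mod_iso_def S_def J_def by auto
  have inj: "u = v" if "f u = f v" "u \<in> S" "v \<in> S" for u v
    using f that by (auto simp: bij_betw_def inj_on_def)
  \<comment> \<open>Applied to \<open>x\<close> now, and to \<open>y\<close> once \<open>y\<close>
    is known to be minimal.\<close>
  have coset: "\<exists>p\<in>carrier R. \<forall>c\<in>carrier R. c \<otimes> u \<in> S \<and> f (c \<otimes> u) = J +>\<^bsub>regular R\<^esub> (c \<otimes> p)"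
    if u: "minimal_element R u" for u
  proof -
    have cu: "c \<otimes> u \<in> S" if "c \<in> carrier R" for c
      unfolding S_def using minimal_element_in_socle[OF u that] .
    have "u \<in> S" using cu[of \<one>] u by (simp add: minimal_element_def)
    then have "f u \<in> carrier (quot_module (regular R) J)" using f by (auto simp: bij_betw_def)
    then obtain p where p: "p \<in> carrier R" "f u = J +>\<^bsub>regular R\<^esub> p"
      by (auto simp: quot_module_def A_RCOSETS_def')
    then have "f (c \<otimes> u) = J +>\<^bsub>regular R\<^esub> (c \<otimes> p)" if "c \<in> carrier R" for c
      using f_smult[OF that \<open>u \<in> S\<close>] L.quot_smult[OF J, of p c] that by simp
    with cu p show ?thesis by blast
  qed
  have zero_iff: "J +>\<^bsub>regular R\<^esub> v = J \<longleftrightarrow> v \<in> J" if "v \<in> carrier R" for v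
    using L.coset_zero_iff[OF J] that by simp
  from coset[OF x] obtain p where p [simp]: "p \<in> carrier R"
    and fx: "\<And>c. c \<in> carrier R \<Longrightarrow> c \<otimes> x \<in> S" "\<And>c. c \<in> carrier R \<Longrightarrow> f (c \<otimes> x) = J +>\<^bsub>regular R\<^esub> (c \<otimes> p)"
    by blast
  \<comment> \<open>The case \<open>c = \<zero>\<close> of the formula for multiples of
    \<open>x\<close> shows that \<open>f\<close> sends zero to the zero coset.\<close>
  have f0: "f \<zero> = J" "\<zero> \<in> S"
    using fx[of \<zero>] zero_iff[of \<zero>] J' by simp_all
  have J_p: "c \<otimes> p \<in> J" if "c \<in> carrier R" "c \<otimes> x = \<zero>" for c
    using fx[OF that(1)] f0 zero_iff[of "c \<otimes> p"] that by simp
  have "p \<notin> J"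
  proof
    assume "p \<in> J"
    then have "f x = f \<zero>" using fx[of \<one>] f0 zero_iff[of p] by simp
    with inj[of x \<zero>] fx(1)[of \<one>] f0 show False by simp
  qed
  then obtain I where I: "maximal_submodule I R (regular R)" "p \<notin> I"
    unfolding J_def jacobson_def by auto
  have sub: "submodule I R (regular R)" using I by (simp add: maximal_submodule_def)
  note sub' = L.submoduleD[OF sub, simplified]
  have "J \<subseteq> I" using I unfolding J_def jacobson_def by auto
  from maximal_left_ideal_comaximal[OF I(1) p I(2)] obtain i r
    where ir: "i \<in> I" "r \<in> carrier R" "\<one> = i \<oplus> r \<otimes> p" by blast
  have [simp]: "i \<in> carrier R" using ir sub' by blast
  \<comment> \<open>Otherwise dix = x for some \<open>d\<close>, and e = 1 - di kills
    \<open>x\<close>, so ep lies in \<open>J\<close> and thus in \<open>I\<close>. Multiplying 1 = i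
    + rp by \<open>e\<close> puts \<open>e\<close> into \<open>I\<close>, hence also 1 = e + di,
    contradicting that \<open>p\<close> is outside \<open>I\<close>.\<close>
  have "i \<otimes> x = \<zero>"
  proof (rule ccontr)
    assume "i \<otimes> x \<noteq> \<zero>"
    then obtain d where d: "d \<in> carrier R" "d \<otimes> (i \<otimes> x) = x"
      using x unfolding minimal_element_def by auto
    define e where "e = \<one> \<ominus> d \<otimes> i"
    have e: "e \<in> carrier R" using d by (simp add: e_def)
    have "e \<otimes> x = \<zero>"
      using d unfolding e_def a_minus_def by (simp add: l_distr l_minus m_assoc r_neg)
    then have "e \<otimes> p \<in> I" using J_p[OF e] \<open>J \<subseteq> I\<close> by blast
    moreover have "e = e \<otimes> i \<oplus> r \<otimes> (e \<otimes> p)"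
    proof -
      have "e = e \<otimes> (i \<oplus> r \<otimes> p)" using e by (simp flip: ir(3))
      also have "\<dots> = e \<otimes> i \<oplus> r \<otimes> (e \<otimes> p)" using e ir(2) by (simp add: r_distr m_lcomm)
      finally show ?thesis .
    qed
    ultimately have "e \<in> I" using sub'(3,4) ir e by metis
    moreover have "\<one> = e \<oplus> d \<otimes> i" using d by (simp add: e_def a_minus_def a_assoc l_neg)
    ultimately have "\<one> \<in> I" using sub'(3,4) ir d by metis
    then have "p \<in> I" using sub'(4)[of p \<one>] by simp
    with I show False by simp
  qed
  then have iy: "i \<otimes> y = \<zero>" using ann by simp
  show "\<exists>a\<in>carrier R. y = x \<otimes> a"
  proof (cases "y = \<zero>")
    case True
    then show ?thesis by (intro bexI[of _ \<zero>]) simp_all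
  next
    case False
    \<comment> \<open>The map sending cx to cy is well defined on the simple ideal of
      \<open>x\<close>: if dcx = x, then 1 - dc annihilates \<open>x\<close>, hence
      \<open>y\<close>.\<close>
    have "minimal_element R y"
      unfolding minimal_element_def
    proof (intro conjI ballI impI)
      fix c assume c: "c \<in> carrier R" "c \<otimes> y \<noteq> \<zero>"
      then have "c \<otimes> x \<noteq> \<zero>" using ann by blast
      then obtain d where d: "d \<in> carrier R" "d \<otimes> (c \<otimes> x) = x"
        using x c unfolding minimal_element_def by auto
      have "(\<one> \<ominus> d \<otimes> c) \<otimes> x = \<zero>"
        using c d unfolding a_minus_def by (simp add: l_distr l_minus m_assoc r_neg)
      then have "(\<one> \<ominus> d \<otimes> c) \<otimes> y = \<zero>" using ann c d by simp
      then have "y \<oplus> \<ominus> (d \<otimes> (c \<otimes> y)) = \<zero>"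
        using c d unfolding a_minus_def by (simp add: l_distr l_minus m_assoc)
      then have "d \<otimes> (c \<otimes> y) = y" using c d minus_equality[of y "\<ominus> (d \<otimes> (c \<otimes> y))"] by simp
      with d show "\<exists>d\<in>carrier R. d \<otimes> (c \<otimes> y) = y" by blast
    qed (use False in auto)
    from coset[OF this] obtain q where q [simp]: "q \<in> carrier R"
      and fy: "\<And>c. c \<in> carrier R \<Longrightarrow> c \<otimes> y \<in> S" "\<And>c. c \<in> carrier R \<Longrightarrow> f (c \<otimes> y) = J +>\<^bsub>regular R\<^esub> (c \<otimes> q)"
      by blast
    have "i \<otimes> q \<in> J" using fy(2)[of i] iy f0 zero_iff[of "i \<otimes> q"] by simp
    \<comment> \<open>Multiply 1 = i + rp by \<open>q\<close>; the term iq lies in \<open>J\<close>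
      because iy = 0.\<close>
    moreover have "q \<ominus> (r \<otimes> q) \<otimes> p = i \<otimes> q"
    proof -
      have "q = (i \<oplus> r \<otimes> p) \<otimes> q" by (simp flip: ir(3))
      also have "\<dots> = i \<otimes> q \<oplus> (r \<otimes> q) \<otimes> p" using ir by (simp add: l_distr r_distr m_ac)
      finally have "q \<ominus> (r \<otimes> q) \<otimes> p = i \<otimes> q \<oplus> (r \<otimes> q) \<otimes> p \<ominus> (r \<otimes> q) \<otimes> p" by simp
      then show ?thesis using ir by (simp add: a_minus_def a_assoc r_neg)
    qed
    ultimately have "J +>\<^bsub>regular R\<^esub> q = J +>\<^bsub>regular R\<^esub> ((r \<otimes> q) \<otimes> p)"
      using L.a_r_coset_eq_iff[OF J, of q "(r \<otimes> q) \<otimes> p"] ir by (simp add: a_minus_def)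
    then have "f y = f ((r \<otimes> q) \<otimes> x)" using fy(2)[of \<one>] fx(2)[of "r \<otimes> q"] ir(2) by simp
    then have "y = (r \<otimes> q) \<otimes> x" using inj fy(1)[of \<one>] fx(1)[of "r \<otimes> q"] ir(2) by simp
    then show ?thesis using ir(2) by (intro bexI[of _ "r \<otimes> q"]) (simp_all add: m_comm)
  qed
qed

text \<open>The principal ideals generated by the powers of \<open>k\<close> descend and become
  stationary. Consequently \<open>k\<close> acts invertibly on any module element on whose multiples
  its powers can be cancelled.\<close>

lemma (in cring) artinian_power_stable:
  assumes art: "artinian_module R (regular R)" and k: "k \<in> carrier R"
  shows "\<exists>n::nat. \<exists>l\<in>carrier R. k [^] n = k [^] n \<otimes> (k \<otimes> l)"
proof -
  interpret L: left_module R "regular R" by (rule left_module_regular)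
  define F where "F n = (\<lambda>c. c \<otimes> k [^] n) ` carrier R" for n :: nat
  have "submodule (F n) R (regular R)" for n
    unfolding L.submodule_iff
  proof (intro conjI ballI)
    show "\<zero>\<^bsub>regular R\<^esub> \<in> F n" unfolding F_def using k by (intro image_eqI[of _ _ \<zero>]) simp_all
    show "u \<oplus>\<^bsub>regular R\<^esub> v \<in> F n" if "u \<in> F n" "v \<in> F n" for u v
      using that k unfolding F_def by (force simp flip: l_distr)
    show "a \<odot>\<^bsub>regular R\<^esub> u \<in> F n" if "a \<in> carrier R" "u \<in> F n" for a u
      using that k unfolding F_def by (force simp flip: m_assoc)
  qed (use k in \<open>auto simp: F_def\<close>)
  moreover have "antimono F"
  proof (rule antimonoI, rule lift_Suc_antimono_le)
    show "F (Suc n) \<subseteq> F n" for n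
    proof
      fix u assume "u \<in> F (Suc n)"
      then obtain c where c: "c \<in> carrier R" "u = c \<otimes> k [^] Suc n" unfolding F_def by blast
      then have "u = (c \<otimes> k) \<otimes> k [^] n" using k by (simp add: m_ac)
      then show "u \<in> F n" unfolding F_def using c k by blast
    qed
  qed
  ultimately obtain n where "F (Suc n) = F n"
    using art unfolding artinian_module_def by (metis le_Suc_eq order_refl)
  moreover have "k [^] n \<in> F n" unfolding F_def using k by (intro image_eqI[of _ _ \<one>]) simp_all
  ultimately obtain l where l: "l \<in> carrier R" "k [^] n = l \<otimes> k [^] Suc n"
    unfolding F_def by blast
  then have "k [^] n = k [^] n \<otimes> (k \<otimes> l)" using k by (simp add: m_ac)
  with l show ?thesis by blast
qed

section \<open>From the ground ring to a Frobenius algebra\<close>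

lemma (in module) left_module: "left_module R M"
  by (intro left_module.intro left_module_axioms.intro R.ring_axioms M.abelian_group_axioms)
     (simp_all add: smult_l_distr smult_r_distr smult_assoc1)

text \<open>Commutativity of the scalars lets the algebra stand on the right-hand side of a pairing
  as well.\<close>

lemma (in module) left_module_opp: "left_module (opp R) M"
proof -
  have "(b \<otimes> a) \<odot>\<^bsub>M\<^esub> x = a \<odot>\<^bsub>M\<^esub> (b \<odot>\<^bsub>M\<^esub> x)"
    if "a \<in> carrier R" "b \<in> carrier R" "x \<in> carrier M" for a b x
    using that by (simp add: R.m_comm[of b a] smult_assoc1)
  then show ?thesis
    by (intro left_module.intro left_module_axioms.intro ring_opp R.ring_axioms M.abelian_group_axioms)
       (simp_all add: smult_l_distr smult_r_distr)
qed

lemma assoc_algebra_opp: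
  assumes "assoc_algebra K A"
  shows "assoc_algebra K (opp A)"
proof -
  interpret module K A by (rule assoc_algebra.axioms[OF assms])
  interpret A: ring A by (rule assoc_algebra.axioms[OF assms])
  note smult_assoc2 = assoc_algebra.smult_assoc2[OF assms]
    and smult_assoc3 = assoc_algebra.smult_assoc3[OF assms]
  show ?thesis
    by (intro assoc_algebra.intro moduleI assoc_algebra_axioms.intro ring_opp A.ring_axioms
          R.cring_axioms abelian_group_opp M.abelian_group_axioms)
       (simp_all add: smult_l_distr smult_r_distr smult_assoc1 smult_assoc2 smult_assoc3)
qed

lemma fin_gen_opp: "fin_gen K A \<Longrightarrow> fin_gen K (opp A)"
  by (simp add: fin_gen_def mod_span_def submodule_def submodule_axioms_def)

lemma frobenius_form_opp: "frobenius_form K A \<phi> \<Longrightarrow> frobenius_form K (opp A) (\<lambda>a b. \<phi> b a)"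
  unfolding frobenius_form_def by simp

text \<open>Since \<phi>(c, xa) = \<phi>(cx, a), an element \<open>c\<close> is orthogonal to xA
  exactly when cx = 0. The annihilator condition therefore places \<open>y\<close> in the double
  orthogonal of xA. To see that xA equals its double orthogonal, it is built up from finitely many
  generators of \<open>A\<close> over \<open>K\<close>.\<close>

lemma frobenius_algebra_minimal_injective:
  fixes K :: "('k, 'x) ring_scheme" and A :: "('k, 'a, 'y) module_scheme"
  assumes alg: "assoc_algebra K A" and fg: "fin_gen K A" and \<phi>: "frobenius_form K A \<phi>"
    and art: "artinian_module K (regular K)" and inj: "minimal_injective K"
  shows "minimal_injective A"
  unfolding minimal_injective_def
proof (intro allI impI, elim conjE)
  interpret module K A by (rule assoc_algebra.axioms[OF alg])
  interpret A: ring A by (rule assoc_algebra.axioms[OF alg])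
  note smult_assoc2 = assoc_algebra.smult_assoc2[OF alg]
    and smult_assoc3 = assoc_algebra.smult_assoc3[OF alg]
  interpret L: left_module K A by (rule left_module)
  note \<phi>_simps = \<phi>[unfolded frobenius_form_def]
  have assoc: "\<phi> (a \<otimes>\<^bsub>A\<^esub> b) c = \<phi> a (b \<otimes>\<^bsub>A\<^esub> c)"
    if "a \<in> carrier A" "b \<in> carrier A" "c \<in> carrier A" for a b c
    using \<phi>_simps that by blast
  \<comment> \<open>The arguments are exchanged so that \<open>right_orth\<close> of a subspace
    consists of the \<open>c\<close> with \<open>\<phi> c t\<close> zero for all its
    \<open>t\<close>; these act by left multiplication in the annihilator condition.\<close>
  interpret P: pairing K A A "\<lambda>a b. \<phi> b a"
  proof (intro pairing.intro pairing_axioms.intro left_module left_module_opp)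
    fix a m n assume "a \<in> carrier K" "m \<in> carrier A" "n \<in> carrier A"
    moreover from this have "\<phi> (a \<odot>\<^bsub>A\<^esub> n) m = a \<otimes>\<^bsub>K\<^esub> \<phi> n m" "\<phi> n m \<in> carrier K"
      using \<phi>_simps by blast+
    ultimately show "\<phi> (a \<odot>\<^bsub>A\<^esub> n) m = \<phi> n m \<otimes>\<^bsub>K\<^esub> a" by (simp add: R.m_comm)
  qed (use \<phi>_simps in blast)+
  fix x y
  assume x: "minimal_element A x" and y [simp]: "y \<in> carrier A"
    and ann: "\<forall>c\<in>carrier A. c \<otimes>\<^bsub>A\<^esub> x = \<zero>\<^bsub>A\<^esub> \<longrightarrow> c \<otimes>\<^bsub>A\<^esub> y = \<zero>\<^bsub>A\<^esub>"
  have [simp]: "x \<in> carrier A" "x \<noteq> \<zero>\<^bsub>A\<^esub>" using x by (simp_all add: minimal_element_def)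
  let ?xA = "(\<lambda>a. x \<otimes>\<^bsub>A\<^esub> a) ` carrier A"
  let ?closed = "\<lambda>U. left_orth K A (\<lambda>a b. \<phi> b a) (right_orth K A (\<lambda>a b. \<phi> b a) U) = U"

  \<comment> \<open>Scalars that do not kill \<open>x\<close> are invertible on \<open>x\<close>:
    this is the residue field structure behind the simplicity of the steps below.\<close>
  have scalar_inverse: "\<exists>l\<in>carrier K. l \<odot>\<^bsub>A\<^esub> (k \<odot>\<^bsub>A\<^esub> x) = x"
    if k: "k \<in> carrier K" "k \<odot>\<^bsub>A\<^esub> x \<noteq> \<zero>\<^bsub>A\<^esub>" for k
  proof -
    have "(k \<odot>\<^bsub>A\<^esub> \<one>\<^bsub>A\<^esub>) \<otimes>\<^bsub>A\<^esub> x = k \<odot>\<^bsub>A\<^esub> x" using k by (simp add: smult_assoc2)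
    with k x obtain d where d: "d \<in> carrier A" "d \<otimes>\<^bsub>A\<^esub> (k \<odot>\<^bsub>A\<^esub> x) = x"
      unfolding minimal_element_def by (metis A.one_closed smult_closed)
    \<comment> \<open>Multiplication by \<open>d\<close> is \<open>K\<close>-linear and undoes
      \<open>k\<close> on \<open>x\<close>, so \<open>k\<close>, and inductively each of its powers,
      can be cancelled on multiples of \<open>x\<close>.\<close>
    have cancel: "z \<odot>\<^bsub>A\<^esub> x = \<zero>\<^bsub>A\<^esub>" if z: "z \<in> carrier K" "(k \<otimes>\<^bsub>K\<^esub> z) \<odot>\<^bsub>A\<^esub> x = \<zero>\<^bsub>A\<^esub>" for z
    proof -
      have "z \<odot>\<^bsub>A\<^esub> x = z \<odot>\<^bsub>A\<^esub> (d \<otimes>\<^bsub>A\<^esub> (k \<odot>\<^bsub>A\<^esub> x))" using d by simp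
      also have "\<dots> = d \<otimes>\<^bsub>A\<^esub> ((k \<otimes>\<^bsub>K\<^esub> z) \<odot>\<^bsub>A\<^esub> x)"
        using z(1) k(1) d(1) by (simp add: R.m_comm[of k z] smult_assoc1 flip: smult_assoc3)
      finally show ?thesis using z d by simp
    qed
    have cancel_pow: "z \<odot>\<^bsub>A\<^esub> x = \<zero>\<^bsub>A\<^esub>"
      if "z \<in> carrier K" "(k [^]\<^bsub>K\<^esub> n \<otimes>\<^bsub>K\<^esub> z) \<odot>\<^bsub>A\<^esub> x = \<zero>\<^bsub>A\<^esub>" for z and n :: nat
      using that
    proof (induction n arbitrary: z)
      case (Suc n)
      then have "z \<in> carrier K" "(k [^]\<^bsub>K\<^esub> n \<otimes>\<^bsub>K\<^esub> (k \<otimes>\<^bsub>K\<^esub> z)) \<odot>\<^bsub>A\<^esub> x = \<zero>\<^bsub>A\<^esub>"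
        using k(1) by (simp_all add: R.m_assoc)
      then show ?case using Suc.IH[of "k \<otimes>\<^bsub>K\<^esub> z"] cancel k(1) by blast
    qed simp
    obtain n :: nat and l where l: "l \<in> carrier K" "k [^]\<^bsub>K\<^esub> n = k [^]\<^bsub>K\<^esub> n \<otimes>\<^bsub>K\<^esub> (k \<otimes>\<^bsub>K\<^esub> l)"
      using R.artinian_power_stable[OF art k(1)] by blast
    \<comment> \<open>Stability makes the n-th power of \<open>k\<close> kill 1 - kl; cancelling
      that power on \<open>x\<close> shows that \<open>l\<close> inverts \<open>k\<close>
      there.\<close>
    have "k [^]\<^bsub>K\<^esub> n \<otimes>\<^bsub>K\<^esub> (\<one>\<^bsub>K\<^esub> \<oplus>\<^bsub>K\<^esub> \<ominus>\<^bsub>K\<^esub> (k \<otimes>\<^bsub>K\<^esub> l))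
        = k [^]\<^bsub>K\<^esub> n \<oplus>\<^bsub>K\<^esub> \<ominus>\<^bsub>K\<^esub> (k [^]\<^bsub>K\<^esub> n \<otimes>\<^bsub>K\<^esub> (k \<otimes>\<^bsub>K\<^esub> l))"
      using k(1) l(1) by (simp add: R.r_distr R.r_minus)
    also have "\<dots> = \<zero>\<^bsub>K\<^esub>" using k(1) l(1) by (simp add: R.r_neg flip: l(2))
    finally have "(\<one>\<^bsub>K\<^esub> \<oplus>\<^bsub>K\<^esub> \<ominus>\<^bsub>K\<^esub> (k \<otimes>\<^bsub>K\<^esub> l)) \<odot>\<^bsub>A\<^esub> x = \<zero>\<^bsub>A\<^esub>"
      using cancel_pow[of "\<one>\<^bsub>K\<^esub> \<oplus>\<^bsub>K\<^esub> \<ominus>\<^bsub>K\<^esub> (k \<otimes>\<^bsub>K\<^esub> l)" n] k(1) l(1) by simp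
    then have "x \<oplus>\<^bsub>A\<^esub> \<ominus>\<^bsub>A\<^esub> (l \<odot>\<^bsub>A\<^esub> (k \<odot>\<^bsub>A\<^esub> x)) = \<zero>\<^bsub>A\<^esub>"
      using k(1) l(1)
      by (simp add: smult_l_distr L.smult_l_minus R.m_comm[of k l] smult_assoc1)
    then have "l \<odot>\<^bsub>A\<^esub> (k \<odot>\<^bsub>A\<^esub> x) = x"
      using k(1) l(1) M.minus_equality[of x "\<ominus>\<^bsub>A\<^esub> (l \<odot>\<^bsub>A\<^esub> (k \<odot>\<^bsub>A\<^esub> x))"] by simp
    with l show ?thesis by blast
  qed

  obtain X where X: "finite X" "X \<subseteq> carrier A" "mod_span K A X = carrier A"
    using fg unfolding fin_gen_def by blast
  \<comment> \<open>Generators are adjoined one at a time. Keeping \<open>U\<close> inside xA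
    ensures that membership in \<open>U\<close> finally yields a factorisation.\<close>
  have "\<exists>U. submodule U K A \<and> ?closed U \<and> U \<subseteq> ?xA \<and> (\<forall>g\<in>X. x \<otimes>\<^bsub>A\<^esub> g \<in> U)"
    using X(1,2)
  proof (induction X rule: finite_induct)
    case empty
    have "submodule {\<zero>\<^bsub>A\<^esub>} K A" by (simp add: L.submodule_iff)
    moreover have "{\<zero>\<^bsub>A\<^esub>} \<subseteq> ?xA" by (auto intro!: image_eqI[of _ _ "\<zero>\<^bsub>A\<^esub>"])
    ultimately show ?case using P.double_orth_zero by blast
  next
    case (insert g F)
    have "F \<subseteq> carrier A" using insert.prems by simp
    from insert.IH[OF this]
    obtain U where "submodule U K A \<and> ?closed U \<and> U \<subseteq> ?xA \<and> (\<forall>g\<in>F. x \<otimes>\<^bsub>A\<^esub> g \<in> U)"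
      by (rule exE)
    then have U: "submodule U K A" "?closed U" "U \<subseteq> ?xA" "\<And>g. g \<in> F \<Longrightarrow> x \<otimes>\<^bsub>A\<^esub> g \<in> U"
      by simp_all
    note U' = L.submoduleD[OF U(1)]
    note [simp] = U'(1)[THEN subsetD]
    have [simp]: "g \<in> carrier A" using insert by simp
    define v where "v = x \<otimes>\<^bsub>A\<^esub> g"
    have [simp]: "v \<in> carrier A" by (simp add: v_def)
    define W where "W = {k \<odot>\<^bsub>A\<^esub> v \<oplus>\<^bsub>A\<^esub> u | k u. k \<in> carrier K \<and> u \<in> U}"
    have W_I: "k \<odot>\<^bsub>A\<^esub> v \<oplus>\<^bsub>A\<^esub> u \<in> W" if "k \<in> carrier K" "u \<in> U" for k u
      using that unfolding W_def by blast
    have W_E: "\<exists>k u. k \<in> carrier K \<and> u \<in> U \<and> w = k \<odot>\<^bsub>A\<^esub> v \<oplus>\<^bsub>A\<^esub> u" if "w \<in> W" for w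
      using that unfolding W_def by blast
    have sub: "submodule W K A"
      unfolding L.submodule_iff
    proof (intro conjI ballI)
      show "W \<subseteq> carrier A" by (auto simp: W_def)
      show "\<zero>\<^bsub>A\<^esub> \<in> W" using W_I[OF R.zero_closed U'(2)] by simp
      show "w \<oplus>\<^bsub>A\<^esub> w' \<in> W" if "w \<in> W" "w' \<in> W" for w w'
      proof -
        obtain k u k' u' where *: "k \<in> carrier K" "u \<in> U" "w = k \<odot>\<^bsub>A\<^esub> v \<oplus>\<^bsub>A\<^esub> u"
          "k' \<in> carrier K" "u' \<in> U" "w' = k' \<odot>\<^bsub>A\<^esub> v \<oplus>\<^bsub>A\<^esub> u'"
          using W_E \<open>w \<in> W\<close> \<open>w' \<in> W\<close> by meson
        then have "w \<oplus>\<^bsub>A\<^esub> w' = (k \<oplus>\<^bsub>K\<^esub> k') \<odot>\<^bsub>A\<^esub> v \<oplus>\<^bsub>A\<^esub> (u \<oplus>\<^bsub>A\<^esub> u')"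
          by (simp add: smult_l_distr M.a_ac)
        then show ?thesis using W_I U'(3) * by simp
      qed
      show "a \<odot>\<^bsub>A\<^esub> w \<in> W" if a: "a \<in> carrier K" and w: "w \<in> W" for a w
      proof -
        obtain k u where *: "k \<in> carrier K" "u \<in> U" "w = k \<odot>\<^bsub>A\<^esub> v \<oplus>\<^bsub>A\<^esub> u"
          using W_E w by blast
        then have "a \<odot>\<^bsub>A\<^esub> w = (a \<otimes>\<^bsub>K\<^esub> k) \<odot>\<^bsub>A\<^esub> v \<oplus>\<^bsub>A\<^esub> (a \<odot>\<^bsub>A\<^esub> u)"
          using a by (simp add: smult_r_distr smult_assoc1)
        then show ?thesis using W_I U'(4) * a by simp
      qed
    qed
    have UW: "U \<subseteq> W"
    proof
      fix u assume "u \<in> U"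
      then show "u \<in> W" using W_I[of "\<zero>\<^bsub>K\<^esub>" u] by simp
    qed
    have "?closed W"
    proof (rule P.double_orth_step[OF inj R.minimal_injective_opp[OF inj] U(1,2) sub UW])
      fix w w' assume w: "w \<in> W" "w \<notin> U" "w' \<in> W"
      obtain k u j u' where *: "k \<in> carrier K" "u \<in> U" "w = k \<odot>\<^bsub>A\<^esub> v \<oplus>\<^bsub>A\<^esub> u"
        "j \<in> carrier K" "u' \<in> U" "w' = j \<odot>\<^bsub>A\<^esub> v \<oplus>\<^bsub>A\<^esub> u'"
        using W_E w by meson
      have kv: "k \<odot>\<^bsub>A\<^esub> v = (k \<odot>\<^bsub>A\<^esub> x) \<otimes>\<^bsub>A\<^esub> g" using * by (simp add: v_def smult_assoc2)
      \<comment> \<open>The vector kv is (kx)g, so kx = 0 would leave w = u in \<open>U\<close>.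
        Hence some \<open>l\<close> inverts \<open>k\<close> on \<open>x\<close>, and therefore on
        \<open>v\<close>.\<close>
      have "k \<odot>\<^bsub>A\<^esub> x \<noteq> \<zero>\<^bsub>A\<^esub>"
      proof
        assume "k \<odot>\<^bsub>A\<^esub> x = \<zero>\<^bsub>A\<^esub>"
        then have "w = u" using * kv by simp
        with * w show False by simp
      qed
      then obtain l where l: "l \<in> carrier K" "l \<odot>\<^bsub>A\<^esub> (k \<odot>\<^bsub>A\<^esub> x) = x"
        using scalar_inverse * by blast
      have lkv: "l \<odot>\<^bsub>A\<^esub> (k \<odot>\<^bsub>A\<^esub> v) = v"
        using l * by (simp add: kv flip: smult_assoc2) (simp add: v_def)
      \<comment> \<open>Multiplying \<open>w\<close> by jl reproduces jv with an error in
        \<open>U\<close>, which this term corrects.\<close>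
      let ?u = "u' \<oplus>\<^bsub>A\<^esub> \<ominus>\<^bsub>A\<^esub> ((j \<otimes>\<^bsub>K\<^esub> l) \<odot>\<^bsub>A\<^esub> u)"
      have "(j \<otimes>\<^bsub>K\<^esub> l) \<odot>\<^bsub>A\<^esub> w = j \<odot>\<^bsub>A\<^esub> v \<oplus>\<^bsub>A\<^esub> (j \<otimes>\<^bsub>K\<^esub> l) \<odot>\<^bsub>A\<^esub> u"
        using * l by (simp add: smult_r_distr smult_assoc1 lkv)
      then have "(j \<otimes>\<^bsub>K\<^esub> l) \<odot>\<^bsub>A\<^esub> w \<oplus>\<^bsub>A\<^esub> ?u = w'"
        using * l by (simp add: M.a_ac M.r_neg M.r_neg2)
      moreover have "?u \<in> U" using * l by (intro U'(3,4,5)) auto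
      moreover have "j \<otimes>\<^bsub>K\<^esub> l \<in> carrier K" using * l by simp
      ultimately show "\<exists>a\<in>carrier K. \<exists>u\<in>U. w' = a \<odot>\<^bsub>A\<^esub> w \<oplus>\<^bsub>A\<^esub> u" by metis
    qed
    moreover have "W \<subseteq> ?xA"
    proof
      fix w assume "w \<in> W"
      then obtain k u where *: "k \<in> carrier K" "u \<in> U" "w = k \<odot>\<^bsub>A\<^esub> v \<oplus>\<^bsub>A\<^esub> u"
        using W_E by blast
      with U(3) obtain a where a: "a \<in> carrier A" "u = x \<otimes>\<^bsub>A\<^esub> a" by blast
      with * have "w = x \<otimes>\<^bsub>A\<^esub> (k \<odot>\<^bsub>A\<^esub> g \<oplus>\<^bsub>A\<^esub> a)"
        by (simp add: v_def A.r_distr smult_assoc3)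
      then show "w \<in> ?xA" by (rule image_eqI) (use * a in simp)
    qed
    moreover have "x \<otimes>\<^bsub>A\<^esub> g \<in> W"
      using W_I[OF R.one_closed U'(2)] by (simp add: v_def)
    ultimately have "submodule W K A \<and> ?closed W \<and> W \<subseteq> ?xA \<and> (\<forall>h\<in>insert g F. x \<otimes>\<^bsub>A\<^esub> h \<in> W)"
      using sub UW U(4) by auto
    then show ?case by (rule exI)
  qed
  then obtain U where "submodule U K A \<and> ?closed U \<and> U \<subseteq> ?xA \<and> (\<forall>g\<in>X. x \<otimes>\<^bsub>A\<^esub> g \<in> U)"
    by (rule exE)
  then have U: "submodule U K A" "?closed U" "U \<subseteq> ?xA" "\<And>g. g \<in> X \<Longrightarrow> x \<otimes>\<^bsub>A\<^esub> g \<in> U"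
    by simp_all
  note U' = L.submoduleD[OF U(1)]
  \<comment> \<open>This \<open>K\<close>-submodule contains the generators of \<open>A\<close>,
    hence is all of \<open>A\<close>, and \<open>U\<close> is the whole of xA.\<close>
  have "submodule {a \<in> carrier A. x \<otimes>\<^bsub>A\<^esub> a \<in> U} K A"
    unfolding L.submodule_iff using U' by (simp add: A.r_distr smult_assoc3)
  then have "mod_span K A X \<subseteq> {a \<in> carrier A. x \<otimes>\<^bsub>A\<^esub> a \<in> U}"
    unfolding mod_span_def using X(2) U(4) by blast
  then have xA: "x \<otimes>\<^bsub>A\<^esub> a \<in> U" if "a \<in> carrier A" for a
    using X(3) that by blast
  have "y \<in> left_orth K A (\<lambda>a b. \<phi> b a) (right_orth K A (\<lambda>a b. \<phi> b a) U)"
    unfolding left_orth_def right_orth_def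
  proof (intro CollectI conjI ballI)
    fix c assume "c \<in> {n \<in> carrier A. \<forall>t\<in>U. \<phi> n t = \<zero>\<^bsub>K\<^esub>}"
    then have c: "c \<in> carrier A" "\<And>t. t \<in> U \<Longrightarrow> \<phi> c t = \<zero>\<^bsub>K\<^esub>" by auto
    have "c \<otimes>\<^bsub>A\<^esub> x = \<zero>\<^bsub>A\<^esub>"
      by (rule P.right_nondegenerate) (use c xA in \<open>simp_all add: assoc\<close>)
    then have "c \<otimes>\<^bsub>A\<^esub> y = \<zero>\<^bsub>A\<^esub>" using ann c by blast
    then show "\<phi> c y = \<zero>\<^bsub>K\<^esub>" using assoc[of c y "\<one>\<^bsub>A\<^esub>"] c P.form_zero_right[of "\<one>\<^bsub>A\<^esub>"] by simp
  qed simp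
  then show "\<exists>a\<in>carrier A. y = x \<otimes>\<^bsub>A\<^esub> a" using U(2,3) by auto
qed

section \<open>The given bilinear form and the orthogonality theorem\<close>

lemma carrier_right_part [simp]: "carrier (right_part N) = carrier N"
  and add_right_part [simp]: "add (right_part N) = add N"
  and zero_right_part [simp]: "\<zero>\<^bsub>right_part N\<^esub> = \<zero>\<^bsub>N\<^esub>"
  and smult_right_part [simp]: "a \<odot>\<^bsub>right_part N\<^esub> n = n \<lhd>\<^bsub>N\<^esub> a"
  by (simp_all add: right_part_def)

text \<open>Inserting one on either side splits the two-sided linearity law. Comparison with the
  zero vector turns injectivity of the maps into the duals into vanishing kernels.\<close>

lemma pairing_bilinear_form:
  assumes M: "left_module A M" and N: "right_module A (right_part N)"
    and bil: "bilinear_form A M N \<beta>" and nondeg: "nondegenerate M N \<beta>"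
  shows "pairing A M (right_part N) \<beta>"
proof -
  interpret M: left_module A M by (rule M)
  interpret N: left_module "opp A" "right_part N" by (rule N)
  have closed: "\<And>m n. \<lbrakk>m \<in> carrier M; n \<in> carrier N\<rbrakk> \<Longrightarrow> \<beta> m n \<in> carrier A"
    and add_l: "\<And>m m' n. \<lbrakk>m \<in> carrier M; m' \<in> carrier M; n \<in> carrier N\<rbrakk>
      \<Longrightarrow> \<beta> (m \<oplus>\<^bsub>M\<^esub> m') n = \<beta> m n \<oplus>\<^bsub>A\<^esub> \<beta> m' n"
    and add_r: "\<And>m n n'. \<lbrakk>m \<in> carrier M; n \<in> carrier N; n' \<in> carrier N\<rbrakk>
      \<Longrightarrow> \<beta> m (n \<oplus>\<^bsub>N\<^esub> n') = \<beta> m n \<oplus>\<^bsub>A\<^esub> \<beta> m n'"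
    and smult: "\<And>a a' m n. \<lbrakk>a \<in> carrier A; a' \<in> carrier A; m \<in> carrier M; n \<in> carrier N\<rbrakk>
      \<Longrightarrow> \<beta> (a \<odot>\<^bsub>M\<^esub> m) (n \<lhd>\<^bsub>N\<^esub> a') = a \<otimes>\<^bsub>A\<^esub> \<beta> m n \<otimes>\<^bsub>A\<^esub> a'"
    using bil unfolding bilinear_form_def by blast+
  have one_N: "n \<lhd>\<^bsub>N\<^esub> \<one>\<^bsub>A\<^esub> = n" if "n \<in> carrier N" for n
    using N.smult_one[of n] that by simp
  have smult_l: "\<beta> (a \<odot>\<^bsub>M\<^esub> m) n = a \<otimes>\<^bsub>A\<^esub> \<beta> m n"
    if "a \<in> carrier A" "m \<in> carrier M" "n \<in> carrier N" for a m n
    using smult[of a "\<one>\<^bsub>A\<^esub>" m n] that by (simp add: one_N closed)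
  have smult_r: "\<beta> m (n \<lhd>\<^bsub>N\<^esub> a) = \<beta> m n \<otimes>\<^bsub>A\<^esub> a"
    if "a \<in> carrier A" "m \<in> carrier M" "n \<in> carrier N" for a m n
    using smult[of "\<one>\<^bsub>A\<^esub>" a m n] that by (simp add: closed)
  have zero_l: "\<beta> \<zero>\<^bsub>M\<^esub> n = \<zero>\<^bsub>A\<^esub>" if "n \<in> carrier N" for n
    using smult_l[of "\<zero>\<^bsub>A\<^esub>" "\<zero>\<^bsub>M\<^esub>" n] that by (simp add: closed)
  have zero_r: "\<beta> m \<zero>\<^bsub>N\<^esub> = \<zero>\<^bsub>A\<^esub>" if "m \<in> carrier M" for m
    using smult_r[of "\<zero>\<^bsub>A\<^esub>" m "\<zero>\<^bsub>N\<^esub>"] that N.smult_r_null[of "\<zero>\<^bsub>A\<^esub>"] N.zero_closed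
    by (simp add: closed)
  have inj_l: "inj_on (\<lambda>m. \<lambda>n\<in>carrier N. \<beta> m n) (carrier M)"
    and inj_r: "inj_on (\<lambda>n. \<lambda>m\<in>carrier M. \<beta> m n) (carrier N)"
    using nondeg by (simp_all add: nondegenerate_def)
  show ?thesis
  proof (intro pairing.intro pairing_axioms.intro M N)
    show "m = \<zero>\<^bsub>M\<^esub>" if "m \<in> carrier M" "\<And>n. n \<in> carrier (right_part N) \<Longrightarrow> \<beta> m n = \<zero>\<^bsub>A\<^esub>" for m
      by (rule inj_onD[OF inj_l]) (use that zero_l in \<open>simp_all cong: restrict_cong\<close>)
    show "n = \<zero>\<^bsub>right_part N\<^esub>" if "n \<in> carrier (right_part N)" "\<And>m. m \<in> carrier M \<Longrightarrow> \<beta> m n = \<zero>\<^bsub>A\<^esub>" for n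
      by (rule inj_onD[OF inj_r]) (use that zero_r N.zero_closed in \<open>simp_all cong: restrict_cong\<close>)
  qed (simp_all add: closed add_l add_r smult_l smult_r)
qed

theorem proposition15:
  fixes K :: "'k ring"
    and A :: "('k, 'a) module"
    and B :: "'b ring"
    and M :: "('a, 'b, 'm) bimodule"
    and N :: "('b, 'a, 'n) bimodule"
    and \<epsilon> :: "'a \<Rightarrow> 'k"
    and \<beta> :: "'m \<Rightarrow> 'n \<Rightarrow> 'a"
  assumes "cring K" and "frobenius_ring K"
    and "nonproj_frobenius_algebra K A" and "frobenius_functional K A \<epsilon>"
    and "ring B"
    and "bimodule A B M" and "bimodule B A N"
    and "finite_length A M" and "finite_length (opp A) (right_part N)"
    and "bilinear_form A M N \<beta>" and "nondegenerate M N \<beta>"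
    and "submodule S (opp A) (right_part N)" and "submodule T A M"
  shows "let \<beta>\<epsilon> = (\<lambda>m n. \<epsilon> (\<beta> m n)) in
    left_orth A M \<beta> S = left_orth K M \<beta>\<epsilon> S \<and>
    right_orth A N \<beta> T = right_orth K N \<beta>\<epsilon> T \<and>
    submodule (left_orth K M \<beta>\<epsilon> S) A M \<and>
    submodule (right_orth K N \<beta>\<epsilon> T) (opp A) (right_part N) \<and>
    right_orth A N \<beta> (left_orth A M \<beta> S) = S \<and>
    right_orth K N \<beta>\<epsilon> (left_orth K M \<beta>\<epsilon> S) = S \<and>
    left_orth A M \<beta> (right_orth A N \<beta> T) = T \<and>
    left_orth K M \<beta>\<epsilon> (right_orth K N \<beta>\<epsilon> T) = T"

proof -
  note K = \<open>cring K\<close> and KF = \<open>frobenius_ring K\<close>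
  interpret K: cring K by (rule K)
  have alg: "assoc_algebra K A" and fg: "fin_gen K A"
    using \<open>nonproj_frobenius_algebra K A\<close> by (simp_all add: nonproj_frobenius_algebra_def)
  interpret module K A by (rule assoc_algebra.axioms[OF alg])
  interpret A: ring A by (rule assoc_algebra.axioms[OF alg])
  obtain \<phi> where \<phi>: "frobenius_form K A \<phi>"
    and \<epsilon>: "\<And>a. a \<in> carrier A \<Longrightarrow> \<epsilon> a = \<phi> \<one>\<^bsub>A\<^esub> a" "\<And>a. a \<in> carrier A \<Longrightarrow> \<epsilon> a = \<phi> a \<one>\<^bsub>A\<^esub>"
    using \<open>frobenius_functional K A \<epsilon>\<close> unfolding frobenius_functional_def by blast
  have art: "artinian_module K (regular K)" using KF by (simp add: frobenius_ring_def)
  have K_inj: "minimal_injective K" by (rule K.frobenius_minimal_injective[OF KF])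
  have inj: "minimal_injective A"
    by (rule frobenius_algebra_minimal_injective[OF alg fg \<phi> art K_inj])
  \<comment> \<open>The opposite algebra carries the form with exchanged arguments over the same
    \<open>K\<close>, so the same lemma applies.\<close>
  have inj_opp: "minimal_injective (opp A)"
    by (rule frobenius_algebra_minimal_injective[OF assoc_algebra_opp[OF alg] fin_gen_opp[OF fg]
          frobenius_form_opp[OF \<phi>] art K_inj])
  have M: "left_module A M" and N: "right_module A (right_part N)"
    using \<open>bimodule A B M\<close> \<open>bimodule B A N\<close> by (simp_all add: bimodule_def)
  interpret P: pairing A M "right_part N" \<beta>
    by (rule pairing_bilinear_form[OF M N]) fact+
  interpret O: pairing "opp A" "right_part N" M "\<lambda>n m. \<beta> m n"
    by (rule P.opposite)
  note S = \<open>submodule S (opp A) (right_part N)\<close> and T = \<open>submodule T A M\<close>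
  note S' = P.right.submoduleD[OF S, simplified] and T' = P.left.submoduleD[OF T]

  have \<phi>0: "\<phi> \<one>\<^bsub>A\<^esub> \<zero>\<^bsub>A\<^esub> = \<zero>\<^bsub>K\<^esub>"
  proof -
    have "\<phi> \<one>\<^bsub>A\<^esub> (\<zero>\<^bsub>K\<^esub> \<odot>\<^bsub>A\<^esub> \<zero>\<^bsub>A\<^esub>) = \<zero>\<^bsub>K\<^esub> \<otimes>\<^bsub>K\<^esub> \<phi> \<one>\<^bsub>A\<^esub> \<zero>\<^bsub>A\<^esub>" "\<phi> \<one>\<^bsub>A\<^esub> \<zero>\<^bsub>A\<^esub> \<in> carrier K"
      using \<phi> unfolding frobenius_form_def by blast+
    then show ?thesis using left_module.smult_r_null[OF left_module, of "\<zero>\<^bsub>K\<^esub>"] by simp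
  qed
  have \<epsilon>_mult: "\<epsilon> (a \<otimes>\<^bsub>A\<^esub> b) = \<phi> a b" if "a \<in> carrier A" "b \<in> carrier A" for a b
  proof -
    have "\<phi> (\<one>\<^bsub>A\<^esub> \<otimes>\<^bsub>A\<^esub> a) b = \<phi> \<one>\<^bsub>A\<^esub> (a \<otimes>\<^bsub>A\<^esub> b)"
      using \<phi> that A.one_closed unfolding frobenius_form_def by blast
    then show ?thesis using that \<epsilon>(1)[of "a \<otimes>\<^bsub>A\<^esub> b"] by simp
  qed
  have \<epsilon>0: "\<epsilon> \<zero>\<^bsub>A\<^esub> = \<zero>\<^bsub>K\<^esub>" using \<epsilon>(1)[of "\<zero>\<^bsub>A\<^esub>"] \<phi>0 by simp
  have nondeg_l: "a = \<zero>\<^bsub>A\<^esub>" if "a \<in> carrier A" "\<And>b. b \<in> carrier A \<Longrightarrow> \<epsilon> (a \<otimes>\<^bsub>A\<^esub> b) = \<zero>\<^bsub>K\<^esub>" for a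
  proof -
    have "\<forall>b\<in>carrier A. \<phi> a b = \<zero>\<^bsub>K\<^esub>" using that \<epsilon>_mult by simp
    then show ?thesis using \<phi> that(1) unfolding frobenius_form_def by blast
  qed
  have nondeg_r: "a = \<zero>\<^bsub>A\<^esub>" if "a \<in> carrier A" "\<And>b. b \<in> carrier A \<Longrightarrow> \<epsilon> (b \<otimes>\<^bsub>A\<^esub> a) = \<zero>\<^bsub>K\<^esub>" for a
  proof -
    have "\<forall>b\<in>carrier A. \<phi> b a = \<zero>\<^bsub>K\<^esub>" using that \<epsilon>_mult by simp
    then show ?thesis using \<phi> that(1) unfolding frobenius_form_def by blast
  qed

  \<comment> \<open>Stated for every submodule, since it is applied to \<open>S\<close> and to the
    orthogonal of \<open>T\<close>.\<close>
  have left_eq: "left_orth K M (\<lambda>m n. \<epsilon> (\<beta> m n)) S = left_orth A M \<beta> S"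
    if S: "submodule S (opp A) (right_part N)" for S
  proof -
    note S' = P.right.submoduleD[OF S, simplified]
    \<comment> \<open>As \<open>S\<close> is stable under \<open>A\<close>, \<epsilon> vanishes on
      every right multiple of \<open>\<beta> m s\<close>, and nondegeneracy of the Frobenius form
      forces this value to be zero.\<close>
    have "\<beta> m s = \<zero>\<^bsub>A\<^esub>" if m: "m \<in> carrier M" "\<And>s. s \<in> S \<Longrightarrow> \<epsilon> (\<beta> m s) = \<zero>\<^bsub>K\<^esub>" and s: "s \<in> S" for m s
    proof (rule nondeg_l)
      show "\<epsilon> (\<beta> m s \<otimes>\<^bsub>A\<^esub> b) = \<zero>\<^bsub>K\<^esub>" if b: "b \<in> carrier A" for b
        using m(2)[OF S'(4)[OF b s]] P.form_smult_right[OF b m(1), of s] s S'(1) by auto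
      show "\<beta> m s \<in> carrier A" using m(1) s S'(1) by auto
    qed
    then show ?thesis unfolding left_orth_def using \<epsilon>0 by auto
  qed
  have right_eq: "right_orth K N (\<lambda>m n. \<epsilon> (\<beta> m n)) T = right_orth A N \<beta> T"
    if T: "submodule T A M" for T
  proof -
    note T' = P.left.submoduleD[OF T]
    have "\<beta> t n = \<zero>\<^bsub>A\<^esub>" if n: "n \<in> carrier N" "\<And>t. t \<in> T \<Longrightarrow> \<epsilon> (\<beta> t n) = \<zero>\<^bsub>K\<^esub>" and t: "t \<in> T" for n t
    proof (rule nondeg_r)
      show "\<epsilon> (b \<otimes>\<^bsub>A\<^esub> \<beta> t n) = \<zero>\<^bsub>K\<^esub>" if b: "b \<in> carrier A" for b
        using n(2)[OF T'(4)[OF b t]] P.form_smult_left[OF b, of t n] t n T'(1) by auto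
      show "\<beta> t n \<in> carrier A" using n(1) t T'(1) by auto
    qed
    then show ?thesis unfolding right_orth_def using \<epsilon>0 by auto
  qed

  have orth_part: "right_orth A (right_part N) \<beta> V = right_orth A N \<beta> V" for V
    by (simp add: right_orth_def)
  have sub_left: "submodule (left_orth A M \<beta> S) A M"
    by (rule P.submodule_left_orth) (use S' in auto)
  have sub_right: "submodule (right_orth A N \<beta> T) (opp A) (right_part N)"
    using P.submodule_right_orth[of T] T' by (simp add: orth_part)
  have "left_orth A M \<beta> (right_orth A N \<beta> T) = T"
    using P.double_orth_finite_length[OF inj inj_opp \<open>finite_length A M\<close> T] by (simp add: orth_part)
  \<comment> \<open>In the opposite pairing the two orthogonals trade places, so the result for
    submodules of \<open>M\<close> gives the one for \<open>S\<close>.\<close>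
  moreover have "right_orth A N \<beta> (left_orth A M \<beta> S) = S"
    using O.double_orth_finite_length[OF inj_opp _ \<open>finite_length (opp A) (right_part N)\<close> S] inj
    by (simp add: left_orth_def right_orth_def)
  ultimately show ?thesis
    \<comment> \<open>The inner \<epsilon>-orthogonals become ordinary ones first; as these are
      submodules, the outer ones can then be replaced too.\<close>
    unfolding Let_def left_eq[OF S] right_eq[OF T] right_eq[OF sub_left] left_eq[OF sub_right]
    using sub_left sub_right by blast
qed

end
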